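(* Let $n\ge 1$ and let $p$ be a positive integer. Let $V_p=\bar V_p/M_p$ be the irreducible $q(n+1)$-module described in the context. The Hermitian form on $V_p$ induced by the Hermitian form $\langle\cdot|\cdot\rangle$ on $\bar V_p$ determined by $$\langle v_0|v_0\rangle=1,\qquad \langle b_i^+v|w\rangle=\langle v|b_i^-w\rangle,\qquad \langle f_i^+v|w\rangle=\langle v|f_i^-w\rangle\qquad (v,w\in\bar V_p,\ i=1,\ldots,n)$$ is positive definite.
   Context: The Lie superalgebra $G=q(n+1)$ over $\mathbb{C}$ has even basis elements $e_{ij}^{\bar 0}$ and odd basis elements $e_{ij}^{\bar 1}$ ($i,j=0,1,\ldots,n$) with superbracket $[\![ e_{ij}^\sigma, e_{kl}^\theta ]\!] = \delta_{jk} e_{il}^{\sigma+\theta} - (-1)^{\sigma\theta}\delta_{il} e_{kj}^{\sigma+\theta}$, $\sigma,\theta\in\mathbb{Z}_2=\{\bar 0,\bar 1\}$. A $G$-module is a complex vector space $V$ (not required to be $\mathbb{Z}_2$-graded) with a linear map $\rho:G\to \mathrm{End}(V)$ such that $\rho([\![x,y]\!])=\rho(x)\rho(y)-(-1)^{\sigma\theta}\rho(y)\rho(x)$ for $x\in G_\sigma$, $y\in G_\theta$; submodules are likewise not required to be graded. For $i=1,\ldots,n$ put $b_i^+=e_{i0}^{\bar 0}$, $f_i^+=e_{i0}^{\bar 1}$, $b_i^-=e_{0i}^{\bar 0}$, $f_i^-=e_{0i}^{\bar 1}$. Let $q(1)=\mathrm{span}\{e_{00}^{\bar 0},e_{00}^{\bar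 1}\}$, $q(n)=\mathrm{span}\{e_{ij}^{\sigma}: 1\le i,j\le n,\ \sigma\in\mathbb{Z}_2\}$, $\tilde G=q(1)\oplus q(n)$, and $P=\mathrm{span}\{b_i^-,f_i^-: 1\le i\le n\}$; $\tilde G+P$ is a subalgebra of $G$. Let $\mathbb{C}v_0$ be the one-dimensional $(\tilde G+P)$-module with $e_{00}^{\bar 0}v_0=p\,v_0$, $e_{00}^{\bar 1}v_0=\sqrt{p}\,v_0$ ($\sqrt p$ the positive square root), and $xv_0=0$ for $x\in q(n)$ and $x\in P$. Define $\bar V_p=\mathrm{Ind}_{\tilde G+P}^{G}\mathbb{C}v_0 = U(G)\otimes_{U(\tilde G+P)}\mathbb{C}v_0$. A basis of $\bar V_p$ is given by the vectors $(b_1^+)^{k_1}(f_1^+)^{l_1}\cdots(b_n^+)^{k_n}(f_n^+)^{l_n}v_0$ with $k_i\in\{0,1,2,\ldots\}$, $l_i\in\{0,1\}$. $M_p$ denotes the maximal $G$-submodule of $\bar V_p$ different from $\bar V_p$ (so $v\in M_p$ if and only if $v_0\notin U(G)v$), and $V_p=\bar V_p/M_p$. The Hermitian form on $\bar V_p$ vanishes whenever one of its arguments lies in $M_p$, so it induces a Hermitian form on the quotient $V_p$. *)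

theory Defs
  imports
    "HOL-Algebra.QuotRing"
    "HOL-Algebra.Module"
    "HOL-Library.Poly_Mapping"
    "HOL-Library.Z2"
    Complex_Main
begin

section \<open>Complex vector spaces and algebras as records\<close>

text \<open>
  Complex vector spaces are records of type \<open>(complex, 'v) module\<close> that are modules over
  \<open>complex_field\<close>. The fields \<open>mult\<close> and \<open>one\<close> of such a record carry the multiplication when the
  space is an associative algebra; otherwise they are irrelevant.
\<close>

definition complex_field :: "complex ring" where
  "complex_field = \<lparr>carrier = UNIV, mult = (*), one = 1, zero = 0, add = (+)\<rparr>"

definition complex_line :: "(complex, complex) module" where
  "complex_line = \<lparr>carrier = UNIV, mult = (*), one = 1, zero = 0, add = (+), smult = (*)\<rparr>"

definition free_space :: "'a set \<Rightarrow> (complex, 'a \<Rightarrow>\<^sub>0 complex) module" where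
  "free_space X = \<lparr>carrier = {f. Poly_Mapping.keys f \<subseteq> X}, mult = undefined, one = undefined,
     zero = 0, add = (+), smult = (\<lambda>c. Poly_Mapping.map ((*) c))\<rparr>"

definition quot_space :: "(complex, 'v) module \<Rightarrow> 'v set \<Rightarrow> (complex, 'v set) module" where
  "quot_space V N = ring.extend (V Quot N)
     (module.fields (\<lambda>c A. \<Union>x\<in>A. N +>\<^bsub>V\<^esub> (c \<odot>\<^bsub>V\<^esub> x)))"

definition lin_span :: "(complex, 'v) module \<Rightarrow> 'v set \<Rightarrow> 'v set" where
  "lin_span V S = (\<lambda>N. submodule N complex_field V) hull S"

text \<open>
  With words as exponents, the product of \<open>HOL-Library.Poly_Mapping\<close> is the product of the
  free associative algebra, i.e. of the tensor algebra of the space with basis \<open>X\<close>.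
\<close>

instantiation list :: (type) monoid_add
begin
definition zero_list :: "'a list" where "zero_list = []"
definition plus_list :: "'a list \<Rightarrow> 'a list \<Rightarrow> 'a list" where "plus_list = (@)"
instance by standard (simp_all add: zero_list_def plus_list_def)
end

definition free_algebra :: "'a set \<Rightarrow> (complex, 'a list \<Rightarrow>\<^sub>0 complex) module" where
  "free_algebra X = \<lparr>carrier = {f. Poly_Mapping.keys f \<subseteq> lists X}, mult = (*), one = 1,
     zero = 0, add = (+), smult = (\<lambda>c. Poly_Mapping.map ((*) c))\<rparr>"


section \<open>Enveloping algebras and induced modules\<close>

text \<open>
  A Lie superalgebra is given by a homogeneous basis \<open>X\<close>, the parities \<open>d\<close> of the basis elements
  and the brackets \<open>br x y\<close> of basis elements, expanded in the basis. By bilinearity the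
  defining relations of the enveloping algebra are only needed for basis elements.
\<close>

definition super_sign :: "bit \<Rightarrow> bit \<Rightarrow> complex" where
  "super_sign s t = (if s * t = 1 then -1 else 1)"

definition degree_one :: "('a \<Rightarrow>\<^sub>0 complex) \<Rightarrow> ('a list \<Rightarrow>\<^sub>0 complex)" where
  "degree_one g = (\<Sum>x\<in>Poly_Mapping.keys g. Poly_Mapping.single [x] (Poly_Mapping.lookup g x))"

definition enveloping_relations ::
    "'a set \<Rightarrow> ('a \<Rightarrow> bit) \<Rightarrow> ('a \<Rightarrow> 'a \<Rightarrow> 'a \<Rightarrow>\<^sub>0 complex) \<Rightarrow> ('a list \<Rightarrow>\<^sub>0 complex) set" where
  "enveloping_relations X d br =
     {Poly_Mapping.single [x, y] 1 - Poly_Mapping.single [y, x] (super_sign (d x) (d y))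
        - degree_one (br x y) | x y. x \<in> X \<and> y \<in> X}"

type_synonym 'a env = "('a list \<Rightarrow>\<^sub>0 complex) set"

definition enveloping_ideal ::
    "'a set \<Rightarrow> ('a \<Rightarrow> bit) \<Rightarrow> ('a \<Rightarrow> 'a \<Rightarrow> 'a \<Rightarrow>\<^sub>0 complex) \<Rightarrow> ('a list \<Rightarrow>\<^sub>0 complex) set" where
  "enveloping_ideal X d br = Idl\<^bsub>free_algebra X\<^esub> (enveloping_relations X d br)"

definition enveloping ::
    "'a set \<Rightarrow> ('a \<Rightarrow> bit) \<Rightarrow> ('a \<Rightarrow> 'a \<Rightarrow> 'a \<Rightarrow>\<^sub>0 complex) \<Rightarrow> (complex, 'a env) module" where
  "enveloping X d br = quot_space (free_algebra X) (enveloping_ideal X d br)"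

definition env_gen ::
    "'a set \<Rightarrow> ('a \<Rightarrow> bit) \<Rightarrow> ('a \<Rightarrow> 'a \<Rightarrow> 'a \<Rightarrow>\<^sub>0 complex) \<Rightarrow> 'a \<Rightarrow> 'a env" where
  "env_gen X d br x = enveloping_ideal X d br +>\<^bsub>free_algebra X\<^esub> Poly_Mapping.single [x] 1"

text \<open>
  Let \<open>U\<close> be an algebra containing (images \<open>j h\<close> of) the elements \<open>h \<in> Y\<close>, and let \<open>Y\<close> act on
  \<open>L\<close> by \<open>\<rho>\<close>. The tensor product of \<open>U\<close> and \<open>L\<close> over the algebra generated by \<open>Y\<close> is the free
  space on the pairs \<open>(u, m)\<close> modulo the bilinearity and balancing relations. Balancing is
  imposed for generators only; this implies it for their products and linear combinations.
\<close>

definition tensor_relations ::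
    "(complex, 'u) module \<Rightarrow> (complex, 'm) module \<Rightarrow> 'a set \<Rightarrow> ('a \<Rightarrow> 'u) \<Rightarrow> ('a \<Rightarrow> 'm \<Rightarrow> 'm)
      \<Rightarrow> ('u \<times> 'm \<Rightarrow>\<^sub>0 complex) set" where
  "tensor_relations U L Y j \<rho> =
     {Poly_Mapping.single (u \<oplus>\<^bsub>U\<^esub> u', m) 1 - Poly_Mapping.single (u, m) 1
        - Poly_Mapping.single (u', m) 1 | u u' m.
        u \<in> carrier U \<and> u' \<in> carrier U \<and> m \<in> carrier L}
   \<union> {Poly_Mapping.single (u, m \<oplus>\<^bsub>L\<^esub> m') 1 - Poly_Mapping.single (u, m) 1
        - Poly_Mapping.single (u, m') 1 | u m m'.
        u \<in> carrier U \<and> m \<in> carrier L \<and> m' \<in> carrier L}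
   \<union> {Poly_Mapping.single (c \<odot>\<^bsub>U\<^esub> u, m) 1 - Poly_Mapping.single (u, m) c | c u m.
        u \<in> carrier U \<and> m \<in> carrier L}
   \<union> {Poly_Mapping.single (u, c \<odot>\<^bsub>L\<^esub> m) 1 - Poly_Mapping.single (u, m) c | c u m.
        u \<in> carrier U \<and> m \<in> carrier L}
   \<union> {Poly_Mapping.single (u \<otimes>\<^bsub>U\<^esub> j h, m) 1 - Poly_Mapping.single (u, \<rho> h m) 1 | u h m.
        u \<in> carrier U \<and> h \<in> Y \<and> m \<in> carrier L}"

definition tensor_null ::
    "(complex, 'u) module \<Rightarrow> (complex, 'm) module \<Rightarrow> 'a set \<Rightarrow> ('a \<Rightarrow> 'u) \<Rightarrow> ('a \<Rightarrow> 'm \<Rightarrow> 'm)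
      \<Rightarrow> ('u \<times> 'm \<Rightarrow>\<^sub>0 complex) set" where
  "tensor_null U L Y j \<rho> =
     lin_span (free_space (carrier U \<times> carrier L)) (tensor_relations U L Y j \<rho>)"

definition tensor_space ::
    "(complex, 'u) module \<Rightarrow> (complex, 'm) module \<Rightarrow> 'a set \<Rightarrow> ('a \<Rightarrow> 'u) \<Rightarrow> ('a \<Rightarrow> 'm \<Rightarrow> 'm)
      \<Rightarrow> (complex, ('u \<times> 'm \<Rightarrow>\<^sub>0 complex) set) module" where
  "tensor_space U L Y j \<rho> =
     quot_space (free_space (carrier U \<times> carrier L)) (tensor_null U L Y j \<rho>)"

definition pure_tensor ::
    "(complex, 'u) module \<Rightarrow> (complex, 'm) module \<Rightarrow> 'a set \<Rightarrow> ('a \<Rightarrow> 'u) \<Rightarrow> ('a \<Rightarrow> 'm \<Rightarrow> 'm)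
      \<Rightarrow> 'u \<Rightarrow> 'm \<Rightarrow> ('u \<times> 'm \<Rightarrow>\<^sub>0 complex) set" where
  "pure_tensor U L Y j \<rho> u m =
     tensor_null U L Y j \<rho> +>\<^bsub>free_space (carrier U \<times> carrier L)\<^esub> Poly_Mapping.single (u, m) 1"

text \<open>The left action of \<open>a \<in> U\<close>, determined by \<open>a \<cdot> (u \<otimes> m) = a u \<otimes> m\<close>.\<close>

definition tensor_act ::
    "(complex, 'u) module \<Rightarrow> (complex, 'm) module \<Rightarrow> 'a set \<Rightarrow> ('a \<Rightarrow> 'u) \<Rightarrow> ('a \<Rightarrow> 'm \<Rightarrow> 'm)
      \<Rightarrow> 'u \<Rightarrow> ('u \<times> 'm \<Rightarrow>\<^sub>0 complex) set \<Rightarrow> ('u \<times> 'm \<Rightarrow>\<^sub>0 complex) set" where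
  "tensor_act U L Y j \<rho> a A =
     (\<Union>f\<in>A. tensor_null U L Y j \<rho> +>\<^bsub>free_space (carrier U \<times> carrier L)\<^esub>
        (\<Sum>(u, m)\<in>Poly_Mapping.keys f.
           Poly_Mapping.single (a \<otimes>\<^bsub>U\<^esub> u, m) (Poly_Mapping.lookup f (u, m))))"


section \<open>The Lie superalgebra q(n+1) and its modules\<close>

text \<open>The triple \<open>(i, j, \<sigma>)\<close> stands for the basis element \<open>e\<^sub>i\<^sub>j\<close> of parity \<open>\<sigma>\<close>.\<close>

type_synonym q_elt = "nat \<times> nat \<times> bit"

definition q_basis :: "nat \<Rightarrow> q_elt set" where
  "q_basis n = {0..n} \<times> {0..n} \<times> UNIV"

fun q_parity :: "q_elt \<Rightarrow> bit" where
  "q_parity (i, j, \<sigma>) = \<sigma>"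

fun q_bracket :: "q_elt \<Rightarrow> q_elt \<Rightarrow> q_elt \<Rightarrow>\<^sub>0 complex" where
  "q_bracket (i, j, \<sigma>) (k, l, \<theta>) =
     (if j = k then Poly_Mapping.single (i, l, \<sigma> + \<theta>) 1 else 0)
   - (if i = l then Poly_Mapping.single (k, j, \<sigma> + \<theta>) (super_sign \<sigma> \<theta>) else 0)"

abbreviation b_plus :: "nat \<Rightarrow> q_elt" where "b_plus i \<equiv> (i, 0, 0)"
abbreviation f_plus :: "nat \<Rightarrow> q_elt" where "f_plus i \<equiv> (i, 0, 1)"
abbreviation b_minus :: "nat \<Rightarrow> q_elt" where "b_minus i \<equiv> (0, i, 0)"
abbreviation f_minus :: "nat \<Rightarrow> q_elt" where "f_minus i \<equiv> (0, i, 1)"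

definition U_q :: "nat \<Rightarrow> (complex, q_elt env) module" where
  "U_q n = enveloping (q_basis n) q_parity q_bracket"

definition gen_q :: "nat \<Rightarrow> q_elt \<Rightarrow> q_elt env" where
  "gen_q n = env_gen (q_basis n) q_parity q_bracket"

text \<open>Basis of \<open>(q(1) \<oplus> q(n)) + P\<close>.\<close>

definition parabolic_basis :: "nat \<Rightarrow> q_elt set" where
  "parabolic_basis n =
     {0} \<times> {0} \<times> UNIV \<union> {1..n} \<times> {1..n} \<times> UNIV \<union> (b_minus ` {1..n} \<union> f_minus ` {1..n})"

text \<open>The action on the one-dimensional module, whose vector \<open>v\<^sub>0\<close> is \<open>1 :: complex\<close>.\<close>

fun line_act :: "nat \<Rightarrow> q_elt \<Rightarrow> complex \<Rightarrow> complex" where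
  "line_act p (i, j, \<sigma>) z =
     (if i = 0 \<and> j = 0
      then (if \<sigma> = 0 then of_nat p else complex_of_real (sqrt (real p))) * z
      else 0)"

type_synonym Vbar_elt = "(q_elt env \<times> complex \<Rightarrow>\<^sub>0 complex) set"

definition Vbar :: "nat \<Rightarrow> nat \<Rightarrow> (complex, Vbar_elt) module" where
  "Vbar n p = tensor_space (U_q n) complex_line (parabolic_basis n) (gen_q n) (line_act p)"

definition vac :: "nat \<Rightarrow> nat \<Rightarrow> Vbar_elt" where
  "vac n p = pure_tensor (U_q n) complex_line (parabolic_basis n) (gen_q n) (line_act p)
     \<one>\<^bsub>U_q n\<^esub> 1"

definition act :: "nat \<Rightarrow> nat \<Rightarrow> q_elt \<Rightarrow> Vbar_elt \<Rightarrow> Vbar_elt" where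
  "act n p x = tensor_act (U_q n) complex_line (parabolic_basis n) (gen_q n) (line_act p)
     (gen_q n x)"

definition q_submodule :: "nat \<Rightarrow> nat \<Rightarrow> Vbar_elt set \<Rightarrow> bool" where
  "q_submodule n p W \<longleftrightarrow>
     submodule W complex_field (Vbar n p) \<and> (\<forall>x\<in>q_basis n. \<forall>v\<in>W. act n p x v \<in> W)"

text \<open>The greatest element, with respect to inclusion, among the proper submodules.\<close>

definition M_max :: "nat \<Rightarrow> nat \<Rightarrow> Vbar_elt set" where
  "M_max n p = (GREATEST W. q_submodule n p W \<and> W \<noteq> carrier (Vbar n p))"

definition V_irr :: "nat \<Rightarrow> nat \<Rightarrow> (complex, Vbar_elt set) module" where
  "V_irr n p = quot_space (Vbar n p) (M_max n p)"


section \<open>Hermitian forms\<close>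

text \<open>Forms are linear in the second argument and conjugate-linear in the first.\<close>

definition hermitian_form :: "(complex, 'v) module \<Rightarrow> ('v \<Rightarrow> 'v \<Rightarrow> complex) \<Rightarrow> bool" where
  "hermitian_form V H \<longleftrightarrow>
     (\<forall>x\<in>carrier V. \<forall>y\<in>carrier V. \<forall>z\<in>carrier V. H x (y \<oplus>\<^bsub>V\<^esub> z) = H x y + H x z) \<and>
     (\<forall>c. \<forall>x\<in>carrier V. \<forall>y\<in>carrier V. H x (c \<odot>\<^bsub>V\<^esub> y) = c * H x y) \<and>
     (\<forall>x\<in>carrier V. \<forall>y\<in>carrier V. H y x = cnj (H x y))"

definition positive_definite :: "(complex, 'v) module \<Rightarrow> ('v \<Rightarrow> 'v \<Rightarrow> complex) \<Rightarrow> bool" where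
  "positive_definite V H \<longleftrightarrow>
     hermitian_form V H \<and> (\<forall>x\<in>carrier V. x \<noteq> \<zero>\<^bsub>V\<^esub> \<longrightarrow> Re (H x x) > 0)"

definition contravariant_form ::
    "nat \<Rightarrow> nat \<Rightarrow> (Vbar_elt \<Rightarrow> Vbar_elt \<Rightarrow> complex) \<Rightarrow> bool" where
  "contravariant_form n p H \<longleftrightarrow>
     hermitian_form (Vbar n p) H \<and> H (vac n p) (vac n p) = 1 \<and>
     (\<forall>i\<in>{1..n}. \<forall>v\<in>carrier (Vbar n p). \<forall>w\<in>carrier (Vbar n p).
        H (act n p (b_plus i) v) w = H v (act n p (b_minus i) w) \<and>
        H (act n p (f_plus i) v) w = H v (act n p (f_minus i) w))"

definition induces_on_quotient ::
    "(complex, 'v) module \<Rightarrow> 'v set \<Rightarrow> ('v \<Rightarrow> 'v \<Rightarrow> complex) \<Rightarrow> ('v set \<Rightarrow> 'v set \<Rightarrow> complex) \<Rightarrow> bool"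
  where
  "induces_on_quotient V N H K \<longleftrightarrow>
     (\<forall>v\<in>carrier V. \<forall>w\<in>carrier V. K (N +>\<^bsub>V\<^esub> v) (N +>\<^bsub>V\<^esub> w) = H v w)"

end

theory Submission
  imports Defs
begin

text \<open>
  The module is realised inside the \<open>p\<close>-th tensor power of the natural representation on
  \<open>\<complex>\<^bsup>n+1|n+1\<^esup>\<close>, where \<open>e\<^sub>i\<^sub>j\<close> and \<open>e\<^sub>j\<^sub>i\<close> of equal parity are adjoint for the standard inner
  product. There the vector \<open>(Q + \<surd>p) u\<close>, with \<open>u\<close> the \<open>p\<close>-th power of the even basis vector with
  index \<open>0\<close> and \<open>Q\<close> the action of the odd \<open>e\<^sub>0\<^sub>0\<close>, satisfies the relations of \<open>v\<^sub>0\<close>. This gives a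
  homomorphism from the induced module, and the inner product pulls back to a positive
  semidefinite contravariant form. A contravariant form is unique because the induced module is
  spanned by words in the \<open>b\<^sub>i\<^sup>+\<close>, \<open>f\<^sub>i\<^sup>+\<close> applied to \<open>v\<^sub>0\<close>; the ordering of the letters, and hence
  linear independence in the PBW theorem, plays no role. On words of length \<open>k\<close> the even \<open>e\<^sub>0\<^sub>0\<close> has
  eigenvalue \<open>p - k\<close>, so the vectors of a proper submodule have no \<open>v\<^sub>0\<close>-component. By contravariance
  they are orthogonal to everything, so the largest proper submodule is the radical of the form.
\<close>

section \<open>The tensor power of the natural representation\<close>

text \<open>
  Vectors of the tensor power are functions on words; a letter \<open>(i, \<tau>)\<close> is the basis vector with
  index \<open>i\<close> and parity \<open>\<tau>\<close>. Odd operators pick up the Koszul sign of each letter they pass.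
\<close>

type_synonym wave = "(nat \<times> bit) list \<Rightarrow> complex"

fun super_op :: "q_elt \<Rightarrow> wave \<Rightarrow> wave" where
  "super_op (i, j, \<sigma>) \<psi> [] = 0"
| "super_op (i, j, \<sigma>) \<psi> ((l, \<tau>) # w) =
     (if l = i then \<psi> ((j, \<tau> + \<sigma>) # w) else 0)
       + super_sign \<sigma> \<tau> * super_op (i, j, \<sigma>) (\<lambda>w. \<psi> ((l, \<tau>) # w)) w"

lemma super_op_Nil [simp]: "super_op x \<psi> [] = 0"
  by (cases x) simp

lemma super_op_add: "super_op x (\<lambda>w. \<psi> w + \<chi> w) w = super_op x \<psi> w + super_op x \<chi> w"
proof (induction x \<psi> w arbitrary: \<chi> rule: super_op.induct)
  case (2 i j \<sigma> \<psi> l \<tau> w)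
  show ?case
    using "2.IH"[of "\<lambda>w. \<chi> ((l, \<tau>) # w)"] by (simp add: algebra_simps)
qed simp

lemma super_op_scale: "super_op x (\<lambda>w. c * \<psi> w) w = c * super_op x \<psi> w"
  by (induction x \<psi> w rule: super_op.induct) (simp_all add: algebra_simps)

lemma super_op_zero [simp]: "super_op x (\<lambda>w. 0) w = 0"
  using super_op_scale[of x 0 "\<lambda>w. 0" w] by simp

lemma super_op_if: "super_op x (\<lambda>w. if P then \<psi> w else 0) w = (if P then super_op x \<psi> w else 0)"
  by simp

text \<open>In the supercommutator the terms where the two operators act on different letters
  cancel, because of the Koszul sign. What remains is the supercommutator of two matrix units on the
  first letter, and the induction hypothesis for the rest of the word.\<close>

lemma super_op_bracket:
  "super_op (i, j, \<sigma>) (super_op (k, l, \<theta>) \<psi>) w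
     - super_sign \<sigma> \<theta> * super_op (k, l, \<theta>) (super_op (i, j, \<sigma>) \<psi>) w =
   (if j = k then super_op (i, l, \<sigma> + \<theta>) \<psi> w else 0)
     - (if i = l then super_sign \<sigma> \<theta> * super_op (k, j, \<sigma> + \<theta>) \<psi> w else 0)"
proof (induction w arbitrary: \<psi>)
  case (Cons a w)
  obtain m \<tau> where a: "a = (m, \<tau>)" by (cases a)
  note IH = Cons.IH[of "\<lambda>w. \<psi> ((m, \<tau>) # w)"]
  show ?case
    using IH unfolding a super_op.simps super_op_add super_op_scale super_op_if
    by (cases \<sigma>; cases \<theta>; cases \<tau>)
       (auto simp: super_sign_def algebra_simps split: if_splits)
qed simp

section \<open>Inner product and adjoint operators\<close>

text \<open>The standard inner product, split along the first letter. It sees only words of length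
  \<open>p\<close> with indices at most \<open>n\<close>, so on the whole type \<open>wave\<close>
  it is merely semidefinite.\<close>

fun wave_inner :: "nat \<Rightarrow> nat \<Rightarrow> wave \<Rightarrow> wave \<Rightarrow> complex" where
  "wave_inner n 0 \<psi> \<chi> = cnj (\<psi> []) * \<chi> []"
| "wave_inner n (Suc p) \<psi> \<chi> =
     (\<Sum>i\<le>n. wave_inner n p (\<lambda>w. \<psi> ((i, 0) # w)) (\<lambda>w. \<chi> ((i, 0) # w))
        + wave_inner n p (\<lambda>w. \<psi> ((i, 1) # w)) (\<lambda>w. \<chi> ((i, 1) # w)))"

lemma wave_inner_add_right:
  "wave_inner n p \<psi> (\<lambda>w. \<chi> w + \<chi>' w) = wave_inner n p \<psi> \<chi> + wave_inner n p \<psi> \<chi>'"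
  by (induction p arbitrary: \<psi> \<chi> \<chi>') (simp_all add: algebra_simps sum.distrib)

lemma wave_inner_scale_right: "wave_inner n p \<psi> (\<lambda>w. c * \<chi> w) = c * wave_inner n p \<psi> \<chi>"
  by (induction p arbitrary: \<psi> \<chi>) (simp_all add: algebra_simps sum_distrib_left)

lemma wave_inner_commute: "wave_inner n p \<chi> \<psi> = cnj (wave_inner n p \<psi> \<chi>)"
proof (induction p arbitrary: \<psi> \<chi>)
  case (Suc p)
  show ?case
    unfolding wave_inner.simps complex_cnj_add cnj_sum Suc[symmetric] ..
qed (simp add: mult.commute)

lemma wave_inner_add_left:
  "wave_inner n p (\<lambda>w. \<chi> w + \<chi>' w) \<psi> = wave_inner n p \<chi> \<psi> + wave_inner n p \<chi>' \<psi>"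
  by (metis complex_cnj_add wave_inner_add_right wave_inner_commute)

lemma wave_inner_scale_left: "wave_inner n p (\<lambda>w. c * \<chi> w) \<psi> = cnj c * wave_inner n p \<chi> \<psi>"
  by (metis complex_cnj_mult wave_inner_scale_right wave_inner_commute)

lemma wave_inner_diff_right:
  "wave_inner n p \<psi> (\<lambda>w. \<chi> w - \<chi>' w) = wave_inner n p \<psi> \<chi> - wave_inner n p \<psi> \<chi>'"
  using wave_inner_add_right[of n p \<psi> \<chi> "\<lambda>w. (-1) * \<chi>' w"]
  by (simp only: wave_inner_scale_right) simp

lemma wave_inner_diff_left:
  "wave_inner n p (\<lambda>w. \<chi> w - \<chi>' w) \<psi> = wave_inner n p \<chi> \<psi> - wave_inner n p \<chi>' \<psi>"
  by (metis complex_cnj_diff wave_inner_diff_right wave_inner_commute)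

lemma wave_inner_zero_right [simp]: "wave_inner n p \<psi> (\<lambda>w. 0) = 0"
  using wave_inner_scale_right[of n p \<psi> 0 "\<lambda>w. 0"] by simp

lemma wave_inner_zero_left [simp]: "wave_inner n p (\<lambda>w. 0) \<psi> = 0"
  using wave_inner_scale_left[of n p 0 "\<lambda>w. 0" \<psi>] by simp

lemma wave_inner_nonneg: "Re (wave_inner n p \<psi> \<psi>) \<ge> 0"
proof (induction p arbitrary: \<psi>)
  case (Suc p)
  then show ?case
    by (auto intro!: sum_nonneg)
qed simp

text \<open>A vanishing sum of nonnegative terms has vanishing terms, so by recursion every
  coefficient of \<open>\<psi>\<close> that the inner product sees is zero. This is how a vector of
  norm zero is recognised as orthogonal to everything.\<close>

lemma wave_inner_null:
  assumes "Re (wave_inner n p \<psi> \<psi>) = 0"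
  shows "wave_inner n p \<psi> \<chi> = 0"
  using assms
proof (induction p arbitrary: \<psi> \<chi>)
  case 0
  then show ?case
    by (auto simp: complex_eq_iff simp flip: power2_eq_square)
next
  case (Suc p)
  let ?f = "\<lambda>i \<tau>. Re (wave_inner n p (\<lambda>w. \<psi> ((i, \<tau>) # w)) (\<lambda>w. \<psi> ((i, \<tau>) # w)))"
  have "(\<Sum>i\<le>n. ?f i 0 + ?f i 1) = 0"
    using Suc.prems by simp
  then have "\<forall>i\<in>{..n}. ?f i 0 + ?f i 1 = 0"
    by (subst (asm) sum_nonneg_eq_0_iff) (auto simp: wave_inner_nonneg)
  then have "?f i 0 = 0 \<and> ?f i 1 = 0" if "i \<le> n" for i
    using that wave_inner_nonneg by (simp add: add_nonneg_eq_0_iff)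
  then show ?case
    using Suc.IH by simp
qed

text \<open>On the first letter the two operators are transposed real matrices, since shifting a
  parity by \<open>\<sigma>\<close> is an involution. On the other letters the Koszul sign is real
  and is fixed by \<open>\<sigma>\<close> and the unchanged first letter. The bounds put
  \<open>i\<close> and \<open>j\<close> in the range of the sum.\<close>

lemma super_op_adjoint:
  assumes "i \<le> n" "j \<le> n"
  shows "wave_inner n p (super_op (i, j, \<sigma>) \<psi>) \<chi> = wave_inner n p \<psi> (super_op (j, i, \<sigma>) \<chi>)"
proof (induction p arbitrary: \<psi> \<chi>)
  case (Suc p)
  \<comment> \<open>The conditions compare a summation index with \<open>i\<close> or
    \<open>j\<close>. Outside the inner product they become Kronecker deltas for
    \<open>sum.delta\<close>.\<close>
  have if_l: "wave_inner n p (\<lambda>w. if P then f w else 0) g = (if P then wave_inner n p f g else 0)"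
    and if_r: "wave_inner n p g (\<lambda>w. if P then f w else 0) = (if P then wave_inner n p g f else 0)"
    for P f g by simp_all
  show ?case
    using assms Suc
    by (cases \<sigma>)
       (simp_all add: wave_inner_add_left wave_inner_add_right wave_inner_scale_left
         wave_inner_scale_right wave_inner_diff_left wave_inner_diff_right if_l if_r
         sum.distrib sum_subtractf sum.delta super_sign_def)
qed simp

text \<open>
  In the span of the words on the letters \<open>(0, 0)\<close> and \<open>(0, 1)\<close> the operator \<open>Q\<close> given by
  \<open>e\<^sub>0\<^sub>0\<close> of odd parity satisfies \<open>Q\<^sup>2 = p\<close>, so \<open>(Q + \<surd>p) u\<close> is an eigenvector of \<open>Q\<close> with
  eigenvalue \<open>\<surd>p\<close>.
\<close>

fun bottom_wave :: "nat \<Rightarrow> wave" where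
  "bottom_wave 0 w = (if w = [] then 1 else 0)"
| "bottom_wave (Suc p) [] = 0"
| "bottom_wave (Suc p) (a # w) = (if a = (0, 0) then bottom_wave p w else 0)"

definition vac_wave :: "nat \<Rightarrow> wave" where
  "vac_wave p w = super_op (0, 0, 1) (bottom_wave p) w + complex_of_real (sqrt (real p)) * bottom_wave p w"

lemma super_op_bottom_wave: "j \<noteq> 0 \<Longrightarrow> super_op (i, j, \<sigma>) (bottom_wave p) w = 0"
proof (induction p arbitrary: w)
  case 0
  show ?case by (induction w) auto
next
  case (Suc p)
  then show ?case by (cases w) (auto simp: super_op_if)
qed

lemma super_op_bottom_wave_diag: "super_op (0, 0, 0) (bottom_wave p) w = of_nat p * bottom_wave p w"
proof (induction p arbitrary: w)
  case 0
  show ?case by (induction w) auto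
next
  case (Suc p)
  then show ?case
    by (cases w) (auto simp: super_op_if super_sign_def algebra_simps split: if_splits)
qed

text \<open>Each term of \<open>Q\<close> flips the parity of one letter, so \<open>Q\<close>
  contributes nothing at the word of \<open>p\<close> letters \<open>(0, 0)\<close>. The coefficient
  of \<open>vac_wave p\<close> there is therefore \<open>\<surd>p\<close>.\<close>

lemma super_op_bottom_wave_bottom:
  "super_op (0, 0, 1) (bottom_wave p) (replicate p (0, 0)) = 0"
  by (induction p) (auto simp: super_op_if)

lemma wave_inner_bottom: "wave_inner n p (bottom_wave p) \<chi> = \<chi> (replicate p (0, 0))"
proof (induction p arbitrary: \<chi>)
  case (Suc p)
  have if_l: "wave_inner n p (\<lambda>w. if P then f w else 0) g = (if P then wave_inner n p f g else 0)"
    for P f g by simp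
  show ?case
    by (simp add: if_l Suc sum.distrib sum.delta)
qed simp

text \<open>A vector of norm zero would be orthogonal to \<open>bottom_wave p\<close>, but that
  inner product is, up to conjugation, the coefficient \<open>\<surd>p\<close>, which is nonzero.
  Positivity later permits division by this norm.\<close>

lemma vac_wave_pos:
  assumes "p \<ge> 1"
  shows "Re (wave_inner n p (vac_wave p) (vac_wave p)) > 0"
proof (rule ccontr)
  assume "\<not> ?thesis"
  then have "Re (wave_inner n p (vac_wave p) (vac_wave p)) = 0"
    using wave_inner_nonneg[of n p "vac_wave p"] by linarith
  then have "wave_inner n p (vac_wave p) (bottom_wave p) = 0"
    by (rule wave_inner_null)
  then have "vac_wave p (replicate p (0, 0)) = 0"
    by (metis complex_cnj_zero_iff wave_inner_bottom wave_inner_commute)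
  moreover have "bottom_wave p (replicate p (0, 0)) = 1"
    by (induction p) auto
  ultimately show False
    using assms by (simp add: vac_wave_def super_op_bottom_wave_bottom)
qed

text \<open>Operators with \<open>j \<noteq> 0\<close> annihilate \<open>bottom_wave p\<close>,
  where only the index 0 occurs. Their bracket with \<open>Q\<close> vanishes or again has second
  index \<open>j\<close>, so they annihilate \<open>Q\<close> applied to it as well. The even
  \<open>(0, 0, 0)\<close> commutes with \<open>Q\<close> and multiplies
  \<open>bottom_wave p\<close> by \<open>p\<close>.\<close>

lemma super_op_vac_wave:
  assumes "h \<in> parabolic_basis n"
  shows "super_op h (vac_wave p) w = line_act p h 1 * vac_wave p w"
proof -
  obtain i j \<sigma> where h: "h = (i, j, \<sigma>)" by (cases h)
  let ?r = "complex_of_real (sqrt (real p))"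
  have vac: "super_op x (vac_wave p) w
      = super_op x (super_op (0, 0, 1) (bottom_wave p)) w + ?r * super_op x (bottom_wave p) w" for x
    using super_op_add[of x _ "\<lambda>w. ?r * bottom_wave p w" w]
    by (simp add: vac_wave_def[abs_def] super_op_scale)
  have r: "?r * ?r = of_nat p"
    by (simp flip: of_real_mult)
  consider "i = 0" "j = 0" | "j \<noteq> 0"
    using assms by (auto simp: h parabolic_basis_def)
  then show ?thesis
  proof cases
    case 1
    have [simp]: "super_op (0, 0, 0) (bottom_wave p) = (\<lambda>w. of_nat p * bottom_wave p w)"
      by (rule ext) (rule super_op_bottom_wave_diag)
    show ?thesis
    proof (cases \<sigma>)
      case zero
      then show ?thesis
        using super_op_bracket[of 0 0 0 0 0 1 "bottom_wave p" w]
        by (simp add: h 1 vac super_op_scale super_sign_def vac_wave_def algebra_simps)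
    next
      \<comment> \<open>The bracket of \<open>(0, 0, 1)\<close> with itself is twice its square, so
        \<open>Q\<^sup>2\<close> is the even \<open>(0, 0, 0)\<close>, which is multiplication by
        \<open>p\<close> here; \<open>r\<close> then splits \<open>p\<close> into two factors
        \<open>\<surd>p\<close>.\<close>
      case one
      then show ?thesis
        using super_op_bracket[of 0 0 1 0 0 1 "bottom_wave p" w]
        by (simp add: h 1 vac super_op_scale super_sign_def vac_wave_def algebra_simps
            flip: r)
    qed
  next
    case 2
    have [simp]: "super_op (i, j, \<sigma>) (bottom_wave p) = (\<lambda>w. 0)"
      "super_op (i, j, \<theta>) (bottom_wave p) = (\<lambda>w. 0)"
      "super_op (0, j, \<theta>) (bottom_wave p) = (\<lambda>w. 0)" for \<theta>
      using 2 by (auto simp: super_op_bottom_wave)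
    show ?thesis
      using 2 super_op_bracket[of i j \<sigma> 0 0 1 "bottom_wave p" w]
      by (simp add: h vac split: if_splits)
  qed
qed

section \<open>Linear extensions\<close>

abbreviation scale :: "complex \<Rightarrow> ('a \<Rightarrow>\<^sub>0 complex) \<Rightarrow> ('a \<Rightarrow>\<^sub>0 complex)" where
  "scale c \<equiv> Poly_Mapping.map ((*) c)"

lemma lookup_scale [simp]: "Poly_Mapping.lookup (scale c f) k = c * Poly_Mapping.lookup f k"
  by (simp add: Poly_Mapping.map.rep_eq when_def)

lemma keys_scale: "Poly_Mapping.keys (scale c f) \<subseteq> Poly_Mapping.keys f"
  by (auto simp: in_keys_iff)

definition lin_ext :: "('a \<Rightarrow> complex) \<Rightarrow> ('a \<Rightarrow>\<^sub>0 complex) \<Rightarrow> complex" where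
  "lin_ext g f = (\<Sum>k\<in>Poly_Mapping.keys f. Poly_Mapping.lookup f k * g k)"

lemma lin_ext_superset:
  assumes "finite K" "Poly_Mapping.keys f \<subseteq> K"
  shows "lin_ext g f = (\<Sum>k\<in>K. Poly_Mapping.lookup f k * g k)"
  unfolding lin_ext_def
  by (rule sum.mono_neutral_left) (use assms in \<open>auto simp: in_keys_iff\<close>)

lemma lin_ext_add: "lin_ext g (f + f') = lin_ext g f + lin_ext g f'"
proof -
  let ?K = "Poly_Mapping.keys f \<union> Poly_Mapping.keys f'"
  have "Poly_Mapping.keys (f + f') \<subseteq> ?K"
    by (rule Poly_Mapping.keys_add)
  then show ?thesis
    by (simp add: lin_ext_superset[of ?K] lookup_add algebra_simps sum.distrib)
qed

lemma lin_ext_zero [simp]: "lin_ext g 0 = 0"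
  by (simp add: lin_ext_def)

lemma lin_ext_scale: "lin_ext g (scale c f) = c * lin_ext g f"
  using keys_scale[of c f]
  by (simp add: lin_ext_superset[of "Poly_Mapping.keys f"] sum_distrib_left algebra_simps)

lemma lin_ext_diff: "lin_ext g (f - f') = lin_ext g f - lin_ext g f'"
  using lin_ext_add[of g "f - f'" f'] by (simp add: algebra_simps)

lemma lin_ext_sum: "lin_ext g (\<Sum>i\<in>A. f i) = (\<Sum>i\<in>A. lin_ext g (f i))"
  by (induction A rule: infinite_finite_induct) (simp_all add: lin_ext_add)

lemma lin_ext_single [simp]: "lin_ext g (Poly_Mapping.single k c) = c * g k"
  by (simp add: lin_ext_def)

lemma sum_single_lookup:
  "(\<Sum>k\<in>Poly_Mapping.keys f. Poly_Mapping.single k (Poly_Mapping.lookup f k)) = f"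
  by (rule poly_mapping_eqI)
     (auto simp: lookup_sum lookup_single when_def in_keys_iff)

text \<open>Multiplication adds exponents, and for words \<open>a + b\<close> is concatenation. This
  is what turns products in the free algebra into composition in
  \<open>poly_op_mult\<close>.\<close>

lemma lin_ext_mult:
  "lin_ext g (f * f') = lin_ext (\<lambda>a. lin_ext (\<lambda>b. g (a + b)) f') f"
proof -
  have "f * f' = (\<Sum>a\<in>Poly_Mapping.keys f. \<Sum>b\<in>Poly_Mapping.keys f'.
      Poly_Mapping.single (a + b) (Poly_Mapping.lookup f a * Poly_Mapping.lookup f' b))"
    (is "_ = ?r")
  proof -
    have "f * f' = (\<Sum>a\<in>Poly_Mapping.keys f. Poly_Mapping.single a (Poly_Mapping.lookup f a)) *
        (\<Sum>b\<in>Poly_Mapping.keys f'. Poly_Mapping.single b (Poly_Mapping.lookup f' b))"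
      by (simp only: sum_single_lookup)
    also have "\<dots> = ?r"
      by (simp only: sum_product Poly_Mapping.mult_single)
    finally show ?thesis .
  qed
  then have "lin_ext g (f * f') = (\<Sum>a\<in>Poly_Mapping.keys f. \<Sum>b\<in>Poly_Mapping.keys f'.
      Poly_Mapping.lookup f a * Poly_Mapping.lookup f' b * g (a + b))"
    by (simp add: lin_ext_sum)
  then show ?thesis
    by (simp add: lin_ext_def sum_distrib_left algebra_simps)
qed

text \<open>A scalar is a multiple of the empty word, and such multiples are central. Hence ring
  ideals are subspaces and left multiplication commutes with scalars.\<close>

lemma scale_conv_mult:
  "scale c f = Poly_Mapping.single [] c * f" "scale c f = f * Poly_Mapping.single [] c"
  for f :: "'a list \<Rightarrow>\<^sub>0 complex"
proof -
  show 1: "scale c f = Poly_Mapping.single [] c * f" for f :: "'a list \<Rightarrow>\<^sub>0 complex"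
    using mult_map_scale_conv_mult[of c f] by (simp add: zero_list_def)
  have "Poly_Mapping.single [] c * (\<Sum>a\<in>A. Poly_Mapping.single a (g a)) =
      (\<Sum>a\<in>A. Poly_Mapping.single a (g a)) * Poly_Mapping.single [] c" for A and g :: "'a list \<Rightarrow> complex"
    by (simp add: sum_distrib_left sum_distrib_right Poly_Mapping.mult_single plus_list_def mult.commute)
  from this[of "Poly_Mapping.lookup f" "Poly_Mapping.keys f"]
  have "Poly_Mapping.single [] c * f = f * Poly_Mapping.single [] c"
    by (simp only: sum_single_lookup)
  then show "scale c f = f * Poly_Mapping.single [] c"
    by (simp add: 1)
qed

section \<open>Quotients of complex vector spaces\<close>

lemma cring_complex_field: "cring complex_field"
proof (rule cringI)
  show "abelian_group complex_field"
    by (rule abelian_groupI) (auto simp: complex_field_def intro: exI[of _ "- x" for x])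
  show "Group.comm_monoid complex_field"
    by (rule Group.comm_monoidI) (auto simp: complex_field_def)
qed (simp add: complex_field_def algebra_simps)

lemma complex_field_simps [simp]:
  "carrier complex_field = UNIV" "x \<otimes>\<^bsub>complex_field\<^esub> y = x * y" "\<one>\<^bsub>complex_field\<^esub> = 1"
  "\<zero>\<^bsub>complex_field\<^esub> = 0" "x \<oplus>\<^bsub>complex_field\<^esub> y = x + y"
  by (simp_all add: complex_field_def)

lemma complex_moduleI:
  assumes "abelian_group V"
    and "\<And>c x. x \<in> carrier V \<Longrightarrow> c \<odot>\<^bsub>V\<^esub> x \<in> carrier V"
    and "\<And>c d x. x \<in> carrier V \<Longrightarrow> (c + d) \<odot>\<^bsub>V\<^esub> x = c \<odot>\<^bsub>V\<^esub> x \<oplus>\<^bsub>V\<^esub> d \<odot>\<^bsub>V\<^esub> x"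
    and "\<And>c x y. x \<in> carrier V \<Longrightarrow> y \<in> carrier V \<Longrightarrow>
      c \<odot>\<^bsub>V\<^esub> (x \<oplus>\<^bsub>V\<^esub> y) = c \<odot>\<^bsub>V\<^esub> x \<oplus>\<^bsub>V\<^esub> c \<odot>\<^bsub>V\<^esub> y"
    and "\<And>c d x. x \<in> carrier V \<Longrightarrow> (c * d) \<odot>\<^bsub>V\<^esub> x = c \<odot>\<^bsub>V\<^esub> (d \<odot>\<^bsub>V\<^esub> x)"
    and "\<And>x. x \<in> carrier V \<Longrightarrow> 1 \<odot>\<^bsub>V\<^esub> x = x"
  shows "Module.module complex_field V"
  by (rule moduleI) (use assms cring_complex_field in auto)

lemma (in Module.module) minus_smult:
  assumes "x \<in> carrier M" shows "\<ominus>\<^bsub>M\<^esub> x = (\<ominus> \<one>) \<odot>\<^bsub>M\<^esub> x"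
  using assms by (simp add: smult_l_minus)

lemma complex_submoduleI:
  assumes "Module.module complex_field V" "H \<subseteq> carrier V" "\<zero>\<^bsub>V\<^esub> \<in> H"
    and "\<And>x y. x \<in> H \<Longrightarrow> y \<in> H \<Longrightarrow> x \<oplus>\<^bsub>V\<^esub> y \<in> H"
    and "\<And>c x. x \<in> H \<Longrightarrow> c \<odot>\<^bsub>V\<^esub> x \<in> H"
  shows "submodule H complex_field V"
proof -
  interpret Module.module complex_field V by fact
  show ?thesis
    by (rule submoduleI) (use assms minus_smult in auto)
qed

lemma complex_submoduleD:
  assumes "Module.module complex_field V" and W: "submodule W complex_field V"
  shows "W \<subseteq> carrier V" "\<zero>\<^bsub>V\<^esub> \<in> W"
    and "x \<in> W \<Longrightarrow> y \<in> W \<Longrightarrow> x \<oplus>\<^bsub>V\<^esub> y \<in> W"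
    and "x \<in> W \<Longrightarrow> c \<odot>\<^bsub>V\<^esub> x \<in> W"
proof -
  interpret Module.module complex_field V by fact
  show "W \<subseteq> carrier V" "\<zero>\<^bsub>V\<^esub> \<in> W"
    and "x \<in> W \<Longrightarrow> y \<in> W \<Longrightarrow> x \<oplus>\<^bsub>V\<^esub> y \<in> W"
    and "x \<in> W \<Longrightarrow> c \<odot>\<^bsub>V\<^esub> x \<in> W"
    using submoduleE[OF W] subgroup.one_closed[OF submodule.axioms(1)[OF W]] by simp_all
qed

lemma submodule_Inter:
  assumes V: "Module.module complex_field V" and "\<N> \<noteq> {}"
    and N: "\<And>N. N \<in> \<N> \<Longrightarrow> submodule N complex_field V"
  shows "submodule (\<Inter>\<N>) complex_field V"
proof -
  interpret Module.module complex_field V by fact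
  show ?thesis
  proof (rule complex_submoduleI[OF V])
    show "\<Inter>\<N> \<subseteq> carrier V"
      using assms(2) submoduleE(1)[OF N] by blast
    show "\<zero>\<^bsub>V\<^esub> \<in> \<Inter>\<N>"
      using N subgroup.one_closed[OF submodule.axioms(1)] by fastforce
  qed (use submoduleE(4,5)[OF N] in auto)
qed

lemma submodule_carrier:
  assumes V: "Module.module complex_field V"
  shows "submodule (carrier V) complex_field V"
proof -
  interpret Module.module complex_field V by fact
  show ?thesis by (rule complex_submoduleI[OF V]) auto
qed

lemma submodule_lin_span:
  assumes "Module.module complex_field V" "S \<subseteq> carrier V"
  shows "submodule (lin_span V S) complex_field V"
  unfolding lin_span_def hull_def
  by (rule submodule_Inter) (use assms submodule_carrier in auto)

context
  fixes V :: "(complex, 'v) module" and N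
  assumes V: "Module.module complex_field V" and N: "submodule N complex_field V"
begin

interpretation Module.module complex_field V by (rule V)
interpretation abelian_subgroup N V
  by (intro abelian_subgroupI3 additive_subgroupI submodule.axioms(1)[OF N] Module.module.axioms(2)[OF V])

lemma quot_space_carrier: "carrier (quot_space V N) = (\<lambda>x. N +>\<^bsub>V\<^esub> x) ` carrier V"
  by (auto simp: quot_space_def ring.extend_def module.fields_def FactRing_def A_RCOSETS_def')

lemma quot_space_zero: "\<zero>\<^bsub>quot_space V N\<^esub> = N +>\<^bsub>V\<^esub> \<zero>\<^bsub>V\<^esub>"
  by (auto simp: quot_space_def ring.extend_def module.fields_def FactRing_def a_subset)

lemma quot_space_add:
  "x \<in> carrier V \<Longrightarrow> y \<in> carrier V \<Longrightarrow>
    (N +>\<^bsub>V\<^esub> x) \<oplus>\<^bsub>quot_space V N\<^esub> (N +>\<^bsub>V\<^esub> y) = N +>\<^bsub>V\<^esub> (x \<oplus>\<^bsub>V\<^esub> y)"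
  by (auto simp: quot_space_def ring.extend_def module.fields_def FactRing_def a_rcos_sum)

lemma quot_space_eq_iff:
  assumes "x \<in> carrier V" "y \<in> carrier V"
  shows "N +>\<^bsub>V\<^esub> x = N +>\<^bsub>V\<^esub> y \<longleftrightarrow> x \<ominus>\<^bsub>V\<^esub> y \<in> N"
proof -
  have "x \<in> N +>\<^bsub>V\<^esub> y \<longleftrightarrow> x \<ominus>\<^bsub>V\<^esub> y \<in> N"
    using a_rcos_module[of y x] assms by (simp add: minus_eq)
  then show ?thesis
    using a_repr_independence'[of x y] a_rcos_self[of x] assms by auto
qed

lemma mem_cosetD:
  assumes "x' \<in> N +>\<^bsub>V\<^esub> x" "x \<in> carrier V"
  shows "x' \<in> carrier V" "N +>\<^bsub>V\<^esub> x' = N +>\<^bsub>V\<^esub> x"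
  using assms a_elemrcos_carrier a_repr_independence' by auto

lemma self_mem_coset: "x \<in> carrier V \<Longrightarrow> x \<in> N +>\<^bsub>V\<^esub> x"
  by (rule a_rcos_self)

text \<open>Scalar multiplication in \<open>quot_space\<close> is a union over all representatives.
  The cosets in this union coincide because differences of representatives, multiplied by
  \<open>c\<close>, stay in \<open>N\<close>.\<close>

lemma quot_space_smult:
  assumes x: "x \<in> carrier V"
  shows "c \<odot>\<^bsub>quot_space V N\<^esub> (N +>\<^bsub>V\<^esub> x) = N +>\<^bsub>V\<^esub> (c \<odot>\<^bsub>V\<^esub> x)"
proof -
  have "N +>\<^bsub>V\<^esub> (c \<odot>\<^bsub>V\<^esub> x') = N +>\<^bsub>V\<^esub> (c \<odot>\<^bsub>V\<^esub> x)" if "x' \<in> N +>\<^bsub>V\<^esub> x" for x'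
  proof -
    note x' = mem_cosetD[OF that x]
    then have "x' \<ominus>\<^bsub>V\<^esub> x \<in> N"
      using quot_space_eq_iff x by blast
    then have "c \<odot>\<^bsub>V\<^esub> (x' \<ominus>\<^bsub>V\<^esub> x) \<in> N"
      using submoduleE(4)[OF N] by simp
    moreover have "c \<odot>\<^bsub>V\<^esub> (x' \<ominus>\<^bsub>V\<^esub> x) = c \<odot>\<^bsub>V\<^esub> x' \<ominus>\<^bsub>V\<^esub> c \<odot>\<^bsub>V\<^esub> x"
      using x x'(1) by (simp add: M.minus_eq smult_r_distr smult_r_minus)
    ultimately show ?thesis
      using x x'(1) by (simp add: quot_space_eq_iff)
  qed
  then have "(\<Union>x'\<in>N +>\<^bsub>V\<^esub> x. N +>\<^bsub>V\<^esub> (c \<odot>\<^bsub>V\<^esub> x')) = N +>\<^bsub>V\<^esub> (c \<odot>\<^bsub>V\<^esub> x)"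
    using self_mem_coset[OF x] by blast
  then show ?thesis
    by (simp add: quot_space_def ring.extend_def module.fields_def)
qed

lemma module_quot_space: "Module.module complex_field (quot_space V N)"
proof (rule complex_moduleI)
  show "abelian_group (quot_space V N)"
  proof (rule abelian_groupI)
    fix A assume "A \<in> carrier (quot_space V N)"
    then obtain x where x: "x \<in> carrier V" "A = N +>\<^bsub>V\<^esub> x"
      by (auto simp: quot_space_carrier)
    then show "\<exists>B\<in>carrier (quot_space V N). B \<oplus>\<^bsub>quot_space V N\<^esub> A = \<zero>\<^bsub>quot_space V N\<^esub>"
      by (intro bexI[of _ "N +>\<^bsub>V\<^esub> (\<ominus>\<^bsub>V\<^esub> x)"])
         (auto simp: quot_space_add quot_space_zero quot_space_carrier l_neg)
  qed (auto simp: quot_space_carrier quot_space_add quot_space_zero a_ac)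
qed (auto simp: quot_space_carrier quot_space_add quot_space_smult smult_r_distr
      smult_l_distr[simplified] smult_assoc1[simplified] smult_one[simplified])

end

section \<open>Free vector spaces and free associative algebras\<close>

lemma free_space_simps [simp]:
  "carrier (free_space X) = {f. Poly_Mapping.keys f \<subseteq> X}" "\<zero>\<^bsub>free_space X\<^esub> = 0"
  "f \<oplus>\<^bsub>free_space X\<^esub> g = f + g" "c \<odot>\<^bsub>free_space X\<^esub> f = scale c f"
  by (simp_all add: free_space_def)

lemma free_algebra_simps [simp]:
  "carrier (free_algebra X) = {f. Poly_Mapping.keys f \<subseteq> lists X}" "\<zero>\<^bsub>free_algebra X\<^esub> = 0"
  "f \<oplus>\<^bsub>free_algebra X\<^esub> g = f + g" "c \<odot>\<^bsub>free_algebra X\<^esub> f = scale c f"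
  "f \<otimes>\<^bsub>free_algebra X\<^esub> g = f * g" "\<one>\<^bsub>free_algebra X\<^esub> = 1"
  by (simp_all add: free_algebra_def)

lemma keys_add_subset:
  "Poly_Mapping.keys f \<subseteq> S \<Longrightarrow> Poly_Mapping.keys g \<subseteq> S \<Longrightarrow> Poly_Mapping.keys (f + g) \<subseteq> S"
  using Poly_Mapping.keys_add[of f g] by blast

lemma keys_diff_subset:
  "Poly_Mapping.keys f \<subseteq> S \<Longrightarrow> Poly_Mapping.keys g \<subseteq> S \<Longrightarrow> Poly_Mapping.keys (f - g) \<subseteq> S"
  using Poly_Mapping.keys_diff[of f g] by blast

lemma keys_scale_subset:
  "Poly_Mapping.keys f \<subseteq> S \<Longrightarrow> Poly_Mapping.keys (scale c f) \<subseteq> S"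
  using keys_scale[of c f] by blast

lemma scale_simps:
  "scale (c + d) f = scale c f + scale d f" "scale c (f + g) = scale c f + scale c g"
  "scale (c * d) f = scale c (scale d f)" "scale 1 f = f"
  by (rule poly_mapping_eqI, simp add: lookup_add algebra_simps)+

lemma scale_0 [simp]: "scale 0 f = 0" "scale c 0 = 0"
  by (rule poly_mapping_eqI, simp)+

lemma module_free_space: "Module.module complex_field (free_space X)"
proof (rule complex_moduleI)
  show "abelian_group (free_space X)"
  proof (rule abelian_groupI)
    show "\<exists>g\<in>carrier (free_space X). g \<oplus>\<^bsub>free_space X\<^esub> f = \<zero>\<^bsub>free_space X\<^esub>"
      if "f \<in> carrier (free_space X)" for f
      using that by (intro bexI[of _ "- f"]) auto
  qed (simp_all add: add_ac keys_add_subset)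
qed (simp_all add: scale_simps keys_scale_subset)

lemma free_space_minus [simp]:
  assumes "f \<in> carrier (free_space X)" "g \<in> carrier (free_space X)"
  shows "f \<ominus>\<^bsub>free_space X\<^esub> g = f - g"
proof -
  interpret Module.module complex_field "free_space X" by (rule module_free_space)
  have "\<ominus>\<^bsub>free_space X\<^esub> g = - g"
    using assms by (intro M.minus_equality) auto
  then show ?thesis
    by (simp add: M.minus_eq)
qed

lemma module_free_algebra: "Module.module complex_field (free_algebra X)"
proof (rule complex_moduleI)
  show "abelian_group (free_algebra X)"
  proof (rule abelian_groupI)
    show "\<exists>g\<in>carrier (free_algebra X). g \<oplus>\<^bsub>free_algebra X\<^esub> f = \<zero>\<^bsub>free_algebra X\<^esub>"
      if "f \<in> carrier (free_algebra X)" for f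
      using that by (intro bexI[of _ "- f"]) auto
  qed (simp_all add: add_ac keys_add_subset)
qed (simp_all add: scale_simps keys_scale_subset)

lemma free_algebra_minus [simp]:
  assumes "f \<in> carrier (free_algebra X)" "g \<in> carrier (free_algebra X)"
  shows "f \<ominus>\<^bsub>free_algebra X\<^esub> g = f - g"
proof -
  interpret Module.module complex_field "free_algebra X" by (rule module_free_algebra)
  have "\<ominus>\<^bsub>free_algebra X\<^esub> g = - g"
    using assms by (intro M.minus_equality) auto
  then show ?thesis
    by (simp add: M.minus_eq)
qed

lemma keys_mult_lists:
  assumes "Poly_Mapping.keys f \<subseteq> lists X" "Poly_Mapping.keys g \<subseteq> lists X"
  shows "Poly_Mapping.keys (f * g) \<subseteq> lists X"
  using Poly_Mapping.keys_mult[of f g] assms by (fastforce simp: plus_list_def)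

lemma ring_free_algebra: "ring (free_algebra X)"
proof (rule ringI)
  show "abelian_group (free_algebra X)"
    using Module.module.axioms(2)[OF module_free_algebra] .
  show "Group.monoid (free_algebra X)"
    by (rule monoidI) (auto simp: zero_list_def mult.assoc dest: subsetD[OF keys_mult_lists])
qed (auto simp: algebra_simps)

section \<open>Modules induced from one-dimensional modules\<close>

lemma complex_line_simps [simp]:
  "carrier complex_line = UNIV" "x \<oplus>\<^bsub>complex_line\<^esub> y = x + y" "c \<odot>\<^bsub>complex_line\<^esub> x = c * x"
  by (simp_all add: complex_line_def)

section \<open>Elements of the free algebra acting by linear operators on functions\<close>

definition linear_op :: "(('b \<Rightarrow> complex) \<Rightarrow> 'b \<Rightarrow> complex) \<Rightarrow> bool" where
  "linear_op T \<longleftrightarrow> (\<forall>\<psi> \<chi>. T (\<lambda>w. \<psi> w + \<chi> w) = (\<lambda>w. T \<psi> w + T \<chi> w)) \<and>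
     (\<forall>c \<psi>. T (\<lambda>w. c * \<psi> w) = (\<lambda>w. c * T \<psi> w))"

definition word_op :: "('a \<Rightarrow> ('b \<Rightarrow> complex) \<Rightarrow> 'b \<Rightarrow> complex) \<Rightarrow> 'a list \<Rightarrow> ('b \<Rightarrow> complex) \<Rightarrow> 'b \<Rightarrow> complex" where
  "word_op T u = foldr T u"

definition poly_op ::
    "('a \<Rightarrow> ('b \<Rightarrow> complex) \<Rightarrow> 'b \<Rightarrow> complex) \<Rightarrow> ('a list \<Rightarrow>\<^sub>0 complex) \<Rightarrow> ('b \<Rightarrow> complex) \<Rightarrow> 'b \<Rightarrow> complex" where
  "poly_op T f \<psi> w = lin_ext (\<lambda>u. word_op T u \<psi> w) f"

lemma linear_op_add: "linear_op T \<Longrightarrow> T (\<lambda>w. \<psi> w + \<chi> w) = (\<lambda>w. T \<psi> w + T \<chi> w)"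
  and linear_op_scale: "linear_op T \<Longrightarrow> T (\<lambda>w. c * \<psi> w) = (\<lambda>w. c * T \<psi> w)"
  by (simp_all add: linear_op_def)

lemma linear_op_zero: "linear_op T \<Longrightarrow> T (\<lambda>w. 0) = (\<lambda>w. 0)"
  using linear_op_scale[of T 0 "\<lambda>w. 0"] by simp

lemma linear_op_sum:
  assumes "linear_op T"
  shows "T (\<lambda>w. \<Sum>k\<in>K. c k * \<psi> k w) = (\<lambda>w. \<Sum>k\<in>K. c k * T (\<psi> k) w)"
  by (induction K rule: infinite_finite_induct)
     (simp_all add: linear_op_zero[OF assms] linear_op_add[OF assms] linear_op_scale[OF assms])

lemma linear_word_op: "(\<And>x. linear_op (T x)) \<Longrightarrow> linear_op (word_op T u)"
  by (induction u) (simp_all add: word_op_def linear_op_def)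

text \<open>The last letter of a word acts first, so concatenated words act by composition.
  Linearity carries a word through the combination \<open>g\<close>.\<close>

lemma poly_op_mult:
  assumes "\<And>x. linear_op (T x)"
  shows "poly_op T (f * g) \<psi> = poly_op T f (poly_op T g \<psi>)"
proof
  fix w
  have "word_op T u (poly_op T g \<psi>) w = lin_ext (\<lambda>v. word_op T (u + v) \<psi> w) g" for u
    unfolding poly_op_def[abs_def] lin_ext_def linear_op_sum[OF linear_word_op[OF assms]]
    by (simp add: word_op_def plus_list_def)
  then show "poly_op T (f * g) \<psi> w = poly_op T f (poly_op T g \<psi>) w"
    by (simp add: poly_op_def lin_ext_mult)
qed

lemma poly_op_simps:
  "poly_op T (f + g) \<psi> w = poly_op T f \<psi> w + poly_op T g \<psi> w"
  "poly_op T (f - g) \<psi> w = poly_op T f \<psi> w - poly_op T g \<psi> w"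
  "poly_op T (scale c f) \<psi> w = c * poly_op T f \<psi> w"
  "poly_op T (Poly_Mapping.single u c) \<psi> w = c * word_op T u \<psi> w"
  "poly_op T 0 \<psi> w = 0"
  by (simp_all add: poly_op_def lin_ext_add lin_ext_diff lin_ext_scale)

lemma poly_op_degree_one: "poly_op T (degree_one g) \<psi> w = lin_ext (\<lambda>x. T x \<psi> w) g"
  by (simp add: poly_op_def degree_one_def lin_ext_sum lin_ext_def[of _ g] word_op_def)

lemma linear_op_poly_op:
  assumes "\<And>x. linear_op (T x)"
  shows "linear_op (poly_op T f)"
  using linear_word_op[of T, OF assms]
  by (simp add: linear_op_def poly_op_def[abs_def] lin_ext_def algebra_simps sum.distrib sum_distrib_left)

section \<open>Structure of a module induced from a line\<close>

locale induced_line =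
  fixes X :: "'a set" and d :: "'a \<Rightarrow> bit" and br :: "'a \<Rightarrow> 'a \<Rightarrow> 'a \<Rightarrow>\<^sub>0 complex"
    and Y :: "'a set" and \<chi> :: "'a \<Rightarrow> complex"
  assumes bracket_closed: "x \<in> X \<Longrightarrow> y \<in> X \<Longrightarrow> Poly_Mapping.keys (br x y) \<subseteq> X"
    and Y_subset: "Y \<subseteq> X"
begin

abbreviation "A \<equiv> free_algebra X"
abbreviation "I \<equiv> enveloping_ideal X d br"
abbreviation "U \<equiv> enveloping X d br"
abbreviation "gen \<equiv> env_gen X d br"
abbreviation "\<rho> \<equiv> (\<lambda>h z. \<chi> h * z)"
abbreviation "F \<equiv> free_space (carrier U \<times> carrier complex_line)"
abbreviation "R \<equiv> tensor_relations U complex_line Y gen \<rho>"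
abbreviation "N \<equiv> tensor_null U complex_line Y gen \<rho>"
abbreviation "T \<equiv> tensor_space U complex_line Y gen \<rho>"
abbreviation "tact \<equiv> tensor_act U complex_line Y gen \<rho>"
abbreviation "cls f \<equiv> I +>\<^bsub>A\<^esub> f"
abbreviation "rel x y \<equiv> Poly_Mapping.single [x, y] 1
  - Poly_Mapping.single [y, x] (super_sign (d x) (d y)) - degree_one (br x y)"

text \<open>The element \<open>f\<close> of the free algebra applied to the generator
  \<open>1 \<otimes> 1\<close>. By \<open>vec_surj\<close> every vector has this form, so
  computations can be carried out with combinations of words.\<close>

definition vec :: "('a list \<Rightarrow>\<^sub>0 complex) \<Rightarrow> ('a env \<times> complex \<Rightarrow>\<^sub>0 complex) set" where
  "vec f = pure_tensor U complex_line Y gen \<rho> (cls f) 1"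

lemma relations_carrier:
  assumes "x \<in> X" "y \<in> X"
  shows "rel x y \<in> carrier A"
proof -
  have "Poly_Mapping.keys (degree_one (br x y)) \<subseteq> lists X"
    unfolding degree_one_def
    using bracket_closed[OF assms] by (intro order_trans[OF keys_sum] UN_least) auto
  then show ?thesis
    using assms by (simp add: keys_diff_subset)
qed

lemma ideal_I: "ideal I A"
  unfolding enveloping_ideal_def enveloping_relations_def
  by (rule ring.genideal_ideal[OF ring_free_algebra]) (use relations_carrier in blast)

lemma rel_in_I: "x \<in> X \<Longrightarrow> y \<in> X \<Longrightarrow> rel x y \<in> I"
  using ring.genideal_self[OF ring_free_algebra, of "enveloping_relations X d br"] relations_carrier
  unfolding enveloping_ideal_def enveloping_relations_def by blast

lemma submodule_I: "submodule I complex_field A"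
proof -
  interpret ideal I A by (rule ideal_I)
  show ?thesis
  proof (rule complex_submoduleI[OF module_free_algebra])
    fix c f assume "f \<in> I"
    then have "Poly_Mapping.single [] c * f \<in> I"
      using I_l_closed[of f "Poly_Mapping.single [] c"] by simp
    then show "c \<odot>\<^bsub>A\<^esub> f \<in> I"
      by (simp add: scale_conv_mult(1))
  next
    show "\<zero>\<^bsub>A\<^esub> \<in> I" by (rule additive_subgroup.zero_closed[OF is_additive_subgroup])
  next
    show "f \<oplus>\<^bsub>A\<^esub> g \<in> I" if "f \<in> I" "g \<in> I" for f g
      using that by (rule additive_subgroup.a_closed[OF is_additive_subgroup])
  qed (rule a_subset)
qed

lemmas cls_eq_iff = quot_space_eq_iff[OF module_free_algebra submodule_I]

lemma carrier_U: "carrier U = cls ` carrier A"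
  unfolding enveloping_def by (rule quot_space_carrier[OF module_free_algebra submodule_I])

lemma add_U: "f \<in> carrier A \<Longrightarrow> g \<in> carrier A \<Longrightarrow> cls f \<oplus>\<^bsub>U\<^esub> cls g = cls (f + g)"
  using quot_space_add[OF module_free_algebra submodule_I] unfolding enveloping_def by simp

lemma smult_U: "f \<in> carrier A \<Longrightarrow> c \<odot>\<^bsub>U\<^esub> cls f = cls (scale c f)"
  using quot_space_smult[OF module_free_algebra submodule_I] unfolding enveloping_def by simp

lemma mult_U: "f \<in> carrier A \<Longrightarrow> g \<in> carrier A \<Longrightarrow> cls f \<otimes>\<^bsub>U\<^esub> cls g = cls (f * g)"
  using ideal.rcoset_mult_add[OF ideal_I, of f g]
  by (simp add: enveloping_def quot_space_def ring.extend_def FactRing_def)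

lemma one_U: "\<one>\<^bsub>U\<^esub> = cls 1"
  by (simp add: enveloping_def quot_space_def ring.extend_def FactRing_def)

lemma gen_conv_cls: "gen x = cls (Poly_Mapping.single [x] 1)"
  by (simp add: env_gen_def)

lemma cls_in_carrier: "f \<in> carrier A \<Longrightarrow> cls f \<in> carrier U"
  unfolding carrier_U by blast

lemma gen_in_carrier: "x \<in> X \<Longrightarrow> gen x \<in> carrier U"
  unfolding gen_conv_cls by (rule cls_in_carrier) simp

lemma closed_A:
  "f \<in> carrier A \<Longrightarrow> g \<in> carrier A \<Longrightarrow> f + g \<in> carrier A"
  "f \<in> carrier A \<Longrightarrow> g \<in> carrier A \<Longrightarrow> f - g \<in> carrier A"
  "f \<in> carrier A \<Longrightarrow> g \<in> carrier A \<Longrightarrow> f * g \<in> carrier A"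
  "f \<in> carrier A \<Longrightarrow> scale c f \<in> carrier A"
  "x \<in> X \<Longrightarrow> Poly_Mapping.single [x] c \<in> carrier A"
  "0 \<in> carrier A" "1 \<in> carrier A"
  by (simp_all add: zero_list_def keys_add_subset keys_diff_subset keys_mult_lists keys_scale_subset)

lemma closed_U:
  assumes "u \<in> carrier U" "u' \<in> carrier U"
  shows "u \<oplus>\<^bsub>U\<^esub> u' \<in> carrier U" "u \<otimes>\<^bsub>U\<^esub> u' \<in> carrier U" "c \<odot>\<^bsub>U\<^esub> u \<in> carrier U"
  using assms closed_A cls_in_carrier unfolding carrier_U by (auto simp: add_U mult_U smult_U)

lemma single_in_F: "u \<in> carrier U \<Longrightarrow> Poly_Mapping.single (u, m) c \<in> carrier F"
  by simp

lemma closed_F: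
  "f \<in> carrier F \<Longrightarrow> g \<in> carrier F \<Longrightarrow> f + g \<in> carrier F"
  "f \<in> carrier F \<Longrightarrow> g \<in> carrier F \<Longrightarrow> f - g \<in> carrier F"
  "f \<in> carrier F \<Longrightarrow> scale c f \<in> carrier F"
  "0 \<in> carrier F"
  by (simp_all add: keys_add_subset keys_diff_subset keys_scale_subset)

lemma in_R:
  "u \<in> carrier U \<Longrightarrow> u' \<in> carrier U \<Longrightarrow> Poly_Mapping.single (u \<oplus>\<^bsub>U\<^esub> u', m) 1
     - Poly_Mapping.single (u, m) 1 - Poly_Mapping.single (u', m) 1 \<in> R"
  "u \<in> carrier U \<Longrightarrow> Poly_Mapping.single (u, m + m') 1
     - Poly_Mapping.single (u, m) 1 - Poly_Mapping.single (u, m') 1 \<in> R"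
  "u \<in> carrier U \<Longrightarrow> Poly_Mapping.single (c \<odot>\<^bsub>U\<^esub> u, m) 1 - Poly_Mapping.single (u, m) c \<in> R"
  "u \<in> carrier U \<Longrightarrow> Poly_Mapping.single (u, c * m) 1 - Poly_Mapping.single (u, m) c \<in> R"
  "u \<in> carrier U \<Longrightarrow> h \<in> Y \<Longrightarrow>
     Poly_Mapping.single (u \<otimes>\<^bsub>U\<^esub> gen h, m) 1 - Poly_Mapping.single (u, \<chi> h * m) 1 \<in> R"
  unfolding tensor_relations_def complex_line_simps by blast+

lemma R_cases [consumes 1]:
  assumes "r \<in> R"
  obtains
    (add_left) u u' m where "u \<in> carrier U" "u' \<in> carrier U"
      "r = Poly_Mapping.single (u \<oplus>\<^bsub>U\<^esub> u', m) 1 - Poly_Mapping.single (u, m) 1 - Poly_Mapping.single (u', m) 1"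
  | (add_right) u m m' where "u \<in> carrier U"
      "r = Poly_Mapping.single (u, m + m') 1 - Poly_Mapping.single (u, m) 1 - Poly_Mapping.single (u, m') 1"
  | (smult_left) c u m where "u \<in> carrier U"
      "r = Poly_Mapping.single (c \<odot>\<^bsub>U\<^esub> u, m) 1 - Poly_Mapping.single (u, m) c"
  | (smult_right) c u m where "u \<in> carrier U"
      "r = Poly_Mapping.single (u, c * m) 1 - Poly_Mapping.single (u, m) c"
  | (balanced) u h m where "u \<in> carrier U" "h \<in> Y"
      "r = Poly_Mapping.single (u \<otimes>\<^bsub>U\<^esub> gen h, m) 1 - Poly_Mapping.single (u, \<chi> h * m) 1"
  using assms unfolding tensor_relations_def complex_line_simps by blast

lemma R_subset: "R \<subseteq> carrier F"
proof
  fix r assume "r \<in> R"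
  then show "r \<in> carrier F"
    by (cases rule: R_cases; hypsubst)
       (intro closed_F single_in_F closed_U gen_in_carrier; (assumption | use Y_subset in blast))+
qed

lemma submodule_N: "submodule N complex_field F"
  unfolding tensor_null_def by (rule submodule_lin_span[OF module_free_space R_subset])

lemma R_subset_N: "R \<subseteq> N"
  unfolding tensor_null_def lin_span_def by (rule hull_subset)

lemma N_minimal: "submodule M complex_field F \<Longrightarrow> R \<subseteq> M \<Longrightarrow> N \<subseteq> M"
  unfolding tensor_null_def lin_span_def by (rule hull_minimal)

lemmas coset_eq_iff = quot_space_eq_iff[OF module_free_space submodule_N]

lemma module_T: "Module.module complex_field T"
  unfolding tensor_space_def by (rule module_quot_space[OF module_free_space submodule_N])

lemma coset_eq_iff_diff:
  assumes "f \<in> carrier F" "g \<in> carrier F"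
  shows "N +>\<^bsub>F\<^esub> f = N +>\<^bsub>F\<^esub> g \<longleftrightarrow> f - g \<in> N"
  using coset_eq_iff[OF assms] free_space_minus[OF assms] by simp

lemma pure_eq:
  assumes "f - g \<in> R" "f \<in> carrier F" "g \<in> carrier F"
  shows "N +>\<^bsub>F\<^esub> f = N +>\<^bsub>F\<^esub> g"
  using assms R_subset_N coset_eq_iff_diff by blast

lemma add_T: "f \<in> carrier F \<Longrightarrow> g \<in> carrier F \<Longrightarrow>
    (N +>\<^bsub>F\<^esub> f) \<oplus>\<^bsub>T\<^esub> (N +>\<^bsub>F\<^esub> g) = N +>\<^bsub>F\<^esub> (f + g)"
  unfolding tensor_space_def using quot_space_add[OF module_free_space submodule_N] by simp

lemma smult_T: "f \<in> carrier F \<Longrightarrow> c \<odot>\<^bsub>T\<^esub> (N +>\<^bsub>F\<^esub> f) = N +>\<^bsub>F\<^esub> (scale c f)"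
  unfolding tensor_space_def using quot_space_smult[OF module_free_space submodule_N] by simp

lemma vec_conv: "vec f = N +>\<^bsub>F\<^esub> Poly_Mapping.single (cls f, 1) 1"
  by (simp add: vec_def pure_tensor_def)

lemma vec_add:
  assumes "f \<in> carrier A" "g \<in> carrier A"
  shows "vec (f + g) = vec f \<oplus>\<^bsub>T\<^esub> vec g"
proof -
  let ?s = "\<lambda>f. Poly_Mapping.single (cls f, 1 :: complex) (1 :: complex)"
  have s: "?s f \<in> carrier F" if "f \<in> carrier A" for f
    using that by (intro single_in_F cls_in_carrier)
  have "?s (f + g) - ?s f - ?s g \<in> R"
    unfolding add_U[OF assms, symmetric] using assms[THEN cls_in_carrier] by (rule in_R(1))
  then have "N +>\<^bsub>F\<^esub> ?s (f + g) = N +>\<^bsub>F\<^esub> (?s f + ?s g)"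
    by (intro pure_eq s closed_A closed_F assms) (simp add: diff_diff_eq)
  then show ?thesis
    unfolding vec_conv using add_T[OF s s] assms by simp
qed

lemma vec_scale:
  assumes "f \<in> carrier A"
  shows "vec (scale c f) = c \<odot>\<^bsub>T\<^esub> vec f"
proof -
  let ?s = "\<lambda>f c. Poly_Mapping.single (cls f, 1 :: complex) (c :: complex)"
  have s: "?s f c \<in> carrier F" if "f \<in> carrier A" for f c
    using that by (intro single_in_F cls_in_carrier)
  have "?s (scale c f) 1 - ?s f c \<in> R"
    unfolding smult_U[OF assms, symmetric] using assms[THEN cls_in_carrier] by (rule in_R(3))
  then have "N +>\<^bsub>F\<^esub> ?s (scale c f) 1 = N +>\<^bsub>F\<^esub> ?s f c"
    by (intro pure_eq s closed_A closed_F assms)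
  then show ?thesis
    unfolding vec_conv using smult_T[OF s] assms by simp
qed

lemma vec_in_carrier: "f \<in> carrier A \<Longrightarrow> vec f \<in> carrier T"
  unfolding vec_conv tensor_space_def quot_space_carrier[OF module_free_space submodule_N]
  using single_in_F cls_in_carrier by blast

text \<open>As the line is one-dimensional, every pure tensor is a multiple of some
  \<open>u \<otimes> 1\<close>, and \<open>u\<close> is the class of some \<open>g\<close>. Sums are
  handled by induction over the support.\<close>

lemma vec_surj:
  assumes "v \<in> carrier T"
  shows "\<exists>f\<in>carrier A. v = vec f"
proof -
  have pure: "\<exists>f\<in>carrier A. N +>\<^bsub>F\<^esub> Poly_Mapping.single (u, m) c = vec f"
    if u: "u \<in> carrier U" for u m c
  proof -
    obtain g where g: "g \<in> carrier A" "u = cls g"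
      using u unfolding carrier_U by blast
    \<comment> \<open>The coefficient \<open>c\<close> first moves into the line; then the whole of
      \<open>c * m\<close> moves out, leaving 1 in the second slot.\<close>
    have "N +>\<^bsub>F\<^esub> Poly_Mapping.single (u, m) c = N +>\<^bsub>F\<^esub> Poly_Mapping.single (u, c * m) 1"
      by (rule pure_eq[symmetric]) (intro in_R u single_in_F)+
    also have "\<dots> = N +>\<^bsub>F\<^esub> Poly_Mapping.single (u, 1) (c * m)"
      by (rule pure_eq) (use in_R(4)[OF u, of "c * m" 1] single_in_F[OF u] in \<open>simp_all del: free_space_simps\<close>)
    also have "\<dots> = (c * m) \<odot>\<^bsub>T\<^esub> vec g"
      using smult_T[OF single_in_F[OF u, of 1 1], of "c * m"] by (simp add: vec_conv g)
    also have "\<dots> = vec (scale (c * m) g)"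
      by (rule vec_scale[symmetric]) (rule g)
    finally show ?thesis
      using closed_A(4)[OF g(1)] by blast
  qed
  obtain g where g: "g \<in> carrier F" "v = N +>\<^bsub>F\<^esub> g"
    using assms unfolding tensor_space_def quot_space_carrier[OF module_free_space submodule_N] by blast
  have "(\<Sum>k\<in>K. Poly_Mapping.single k (c k)) \<in> carrier F \<and>
      (\<exists>f\<in>carrier A. N +>\<^bsub>F\<^esub> (\<Sum>k\<in>K. Poly_Mapping.single k (c k)) = vec f)"
    if "finite K" "K \<subseteq> carrier U \<times> UNIV" for K and c :: "_ \<Rightarrow> complex"
    using that
  proof (induction K)
    case empty
    have "vec 0 = N +>\<^bsub>F\<^esub> 0"
      using vec_scale[of 0 0] smult_T[OF single_in_F[OF cls_in_carrier, of 0 1 1], of 0]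
      by (simp add: vec_conv)
    then show ?case
      using closed_A(6) by (auto simp del: free_algebra_simps(1) intro!: bexI[of _ 0])
  next
    case (insert k K)
    obtain u m where k: "k = (u, m)" "u \<in> carrier U" using insert by auto
    let ?r = "\<Sum>k\<in>K. Poly_Mapping.single k (c k)"
    obtain f f' where f: "f \<in> carrier A" "N +>\<^bsub>F\<^esub> Poly_Mapping.single k (c k) = vec f"
        "f' \<in> carrier A" "N +>\<^bsub>F\<^esub> ?r = vec f'"
      using pure[OF k(2)] insert k(1) by blast
    have c: "Poly_Mapping.single k (c k) \<in> carrier F" "?r \<in> carrier F"
      using insert single_in_F[OF k(2)] k(1) by blast+
    have "N +>\<^bsub>F\<^esub> (Poly_Mapping.single k (c k) + ?r) = vec (f + f')"
      using add_T[OF c] f vec_add[OF f(1,3)] by simp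
    then show ?case
      using closed_F(1)[OF c] closed_A(1)[OF f(1,3)] insert(1,2) by auto
  qed
  from this[of "Poly_Mapping.keys g" "Poly_Mapping.lookup g"] g show ?thesis
    by (simp add: sum_single_lookup)
qed

lemma distrib_U:
  assumes "a \<in> carrier U" "u \<in> carrier U" "u' \<in> carrier U"
  shows "a \<otimes>\<^bsub>U\<^esub> (u \<oplus>\<^bsub>U\<^esub> u') = a \<otimes>\<^bsub>U\<^esub> u \<oplus>\<^bsub>U\<^esub> a \<otimes>\<^bsub>U\<^esub> u'"
    and "a \<otimes>\<^bsub>U\<^esub> (c \<odot>\<^bsub>U\<^esub> u) = c \<odot>\<^bsub>U\<^esub> (a \<otimes>\<^bsub>U\<^esub> u)"
    and "a \<otimes>\<^bsub>U\<^esub> (u \<otimes>\<^bsub>U\<^esub> u') = a \<otimes>\<^bsub>U\<^esub> u \<otimes>\<^bsub>U\<^esub> u'"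
proof -
  obtain f g g' where "f \<in> carrier A" "g \<in> carrier A" "g' \<in> carrier A"
      and [simp]: "a = cls f" "u = cls g" "u' = cls g'"
    using assms unfolding carrier_U by blast
  note A = this(1-3)
  have "f * scale c g = scale c (f * g)"
    by (simp add: scale_conv_mult(2) mult.assoc)
  then show "a \<otimes>\<^bsub>U\<^esub> (u \<oplus>\<^bsub>U\<^esub> u') = a \<otimes>\<^bsub>U\<^esub> u \<oplus>\<^bsub>U\<^esub> a \<otimes>\<^bsub>U\<^esub> u'"
    and "a \<otimes>\<^bsub>U\<^esub> (c \<odot>\<^bsub>U\<^esub> u) = c \<odot>\<^bsub>U\<^esub> (a \<otimes>\<^bsub>U\<^esub> u)"
    and "a \<otimes>\<^bsub>U\<^esub> (u \<otimes>\<^bsub>U\<^esub> u') = a \<otimes>\<^bsub>U\<^esub> u \<otimes>\<^bsub>U\<^esub> u'"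
    using A closed_A(1,3,4)
    by (simp_all del: free_algebra_simps(1) add: add_U mult_U smult_U distrib_left mult.assoc)
qed

definition left_mult :: "'a env \<Rightarrow> ('a env \<times> complex \<Rightarrow>\<^sub>0 complex) \<Rightarrow> ('a env \<times> complex \<Rightarrow>\<^sub>0 complex)" where
  "left_mult a f = (\<Sum>(u, m)\<in>Poly_Mapping.keys f.
     Poly_Mapping.single (a \<otimes>\<^bsub>U\<^esub> u, m) (Poly_Mapping.lookup f (u, m)))"

text \<open>In the defining sum the index set depends on \<open>f\<close>. Expressing each
  coefficient through \<open>lin_ext\<close> makes linearity in \<open>f\<close> immediate.\<close>

lemma lookup_left_mult:
  "Poly_Mapping.lookup (left_mult a f) k = lin_ext (\<lambda>(u, m). 1 when (a \<otimes>\<^bsub>U\<^esub> u, m) = k) f"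
  by (simp add: left_mult_def lin_ext_def lookup_sum lookup_single when_def case_prod_unfold if_distrib
      cong: if_cong)

lemma left_mult_simps:
  "left_mult a (f + g) = left_mult a f + left_mult a g"
  "left_mult a (f - g) = left_mult a f - left_mult a g"
  "left_mult a (scale c f) = scale c (left_mult a f)"
  "left_mult a 0 = 0"
  by (rule poly_mapping_eqI,
      simp add: lookup_left_mult lookup_add lookup_minus lin_ext_add lin_ext_diff lin_ext_scale)+

lemma left_mult_single:
  "left_mult a (Poly_Mapping.single (u, m) c) = Poly_Mapping.single (a \<otimes>\<^bsub>U\<^esub> u, m) c"
  by (simp add: left_mult_def)

lemma left_mult_in_F:
  assumes "a \<in> carrier U" "f \<in> carrier F"
  shows "left_mult a f \<in> carrier F"
proof -
  have "Poly_Mapping.keys (left_mult a f) \<subseteq> carrier U \<times> UNIV"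
    unfolding left_mult_def
    by (rule order_trans[OF keys_sum], rule UN_least)
       (use assms closed_U(2)[OF assms(1)] in \<open>auto split: if_splits prod.splits\<close>)
  then show ?thesis by simp
qed

text \<open>Left multiplication sends each tensor relation to one of the same kind. The preimage of
  \<open>N\<close> is thus a subspace containing \<open>R\<close>, and \<open>N\<close> is the least
  such subspace.\<close>

lemma left_mult_in_N:
  assumes a: "a \<in> carrier U" and "f \<in> N"
  shows "left_mult a f \<in> N"
proof -
  interpret Module.module complex_field F by (rule module_free_space)
  let ?M = "{f \<in> carrier F. left_mult a f \<in> N}"
  note N = submoduleE[OF submodule_N]
  have zero: "0 \<in> N"
    using subgroup.one_closed[OF submodule.axioms(1)[OF submodule_N]] by simp
  have "submodule ?M complex_field F"
    using N(4,5) zero closed_F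
    by (intro complex_submoduleI[OF module_free_space])
       (auto simp: left_mult_simps simp del: free_space_simps(1))
  moreover have "R \<subseteq> ?M"
  proof
    fix r assume r: "r \<in> R"
    then have "left_mult a r \<in> R"
    proof (cases rule: R_cases)
      case (balanced u h m)
      then show ?thesis
        using in_R(5)[of "a \<otimes>\<^bsub>U\<^esub> u" h] a gen_in_carrier[of h] Y_subset closed_U
        by (auto simp: left_mult_simps left_mult_single distrib_U)
    qed (use a closed_U in \<open>simp_all add: left_mult_simps left_mult_single distrib_U in_R\<close>)
    then show "r \<in> ?M"
      using r R_subset R_subset_N by blast
  qed
  ultimately show ?thesis
    using N_minimal assms(2) by blast
qed

text \<open>\<open>tensor_act\<close> is a union over representatives. Left multiplication preserves
  \<open>N\<close>, so all the cosets in the union agree.\<close>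

lemma tact_coset:
  assumes a: "a \<in> carrier U" and f: "f \<in> carrier F"
  shows "tact a (N +>\<^bsub>F\<^esub> f) = N +>\<^bsub>F\<^esub> left_mult a f"
proof -
  have "N +>\<^bsub>F\<^esub> left_mult a f' = N +>\<^bsub>F\<^esub> left_mult a f" if "f' \<in> N +>\<^bsub>F\<^esub> f" for f'
  proof -
    note f' = mem_cosetD[OF module_free_space submodule_N that f]
    then have "f' - f \<in> N"
      using coset_eq_iff_diff[OF _ f] by blast
    then have "left_mult a f' - left_mult a f \<in> N"
      using left_mult_in_N[OF a] by (simp flip: left_mult_simps(2))
    then show ?thesis
      using coset_eq_iff_diff[OF left_mult_in_F[OF a f'(1)] left_mult_in_F[OF a f]] by blast
  qed
  then have "(\<Union>f'\<in>N +>\<^bsub>F\<^esub> f. N +>\<^bsub>F\<^esub> left_mult a f') = N +>\<^bsub>F\<^esub> left_mult a f"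
    using self_mem_coset[OF module_free_space submodule_N f] by blast
  moreover have "tact a (N +>\<^bsub>F\<^esub> f) = (\<Union>f'\<in>N +>\<^bsub>F\<^esub> f. N +>\<^bsub>F\<^esub> left_mult a f')"
    unfolding tensor_act_def left_mult_def ..
  ultimately show ?thesis
    by simp
qed

lemma tact_vec:
  assumes "x \<in> X" "f \<in> carrier A"
  shows "tact (gen x) (vec f) = vec (Poly_Mapping.single [x] 1 * f)"
  unfolding vec_conv tact_coset[OF gen_in_carrier[OF assms(1)] single_in_F[OF cls_in_carrier[OF assms(2)]]]
  by (simp only: left_mult_single gen_conv_cls mult_U[OF closed_A(5)[OF assms(1)] assms(2)])

text \<open>The ideal is two-sided, so a defining relation may be multiplied by \<open>f\<close> on
  the right. On words this exchanges the two leftmost letters at the price of a bracket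
  term.\<close>

lemma vec_relation:
  assumes "x \<in> X" "y \<in> X" "f \<in> carrier A"
  shows "vec (Poly_Mapping.single [x, y] 1 * f) =
    vec (Poly_Mapping.single [y, x] (super_sign (d x) (d y)) * f + degree_one (br x y) * f)"
proof -
  interpret ideal I A by (rule ideal_I)
  have r: "rel x y * f \<in> I"
    using I_r_closed[OF rel_in_I[OF assms(1,2)] assms(3)] by simp
  have xy: "Poly_Mapping.single [x, y] 1 \<in> carrier A"
    "Poly_Mapping.single [y, x] (super_sign (d x) (d y)) \<in> carrier A"
    using assms by auto
  have "degree_one (br x y) \<in> carrier A"
    using closed_A(2)[OF closed_A(2)[OF xy] relations_carrier[OF assms(1,2)]] by simp
  then have "cls (Poly_Mapping.single [x, y] 1 * f) =
      cls (Poly_Mapping.single [y, x] (super_sign (d x) (d y)) * f + degree_one (br x y) * f)"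
    using r xy closed_A(3)[OF _ assms(3)] closed_A(1)
    by (subst cls_eq_iff)
       (simp_all add: free_algebra_minus algebra_simps del: free_algebra_simps(1))
  then show ?thesis
    by (simp add: vec_conv)
qed

text \<open>The balancing relation for \<open>u = 1\<close>: the generator \<open>h\<close> passes
  through the tensor sign and acts on the line by \<open>\<chi> h\<close>.\<close>

lemma vec_line:
  assumes "h \<in> Y"
  shows "vec (Poly_Mapping.single [h] 1) = vec (scale (\<chi> h) 1)"
proof -
  have one: "1 \<in> carrier A" and h: "Poly_Mapping.single [h] 1 \<in> carrier A"
    using assms Y_subset by (auto simp: zero_list_def)
  have u: "cls 1 \<in> carrier U"
    by (rule cls_in_carrier[OF one])
  have "cls (Poly_Mapping.single [h] 1) = cls 1 \<otimes>\<^bsub>U\<^esub> gen h"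
    unfolding gen_conv_cls using mult_U[OF one h] by simp
  then have "vec (Poly_Mapping.single [h] 1) = N +>\<^bsub>F\<^esub> Poly_Mapping.single (cls 1 \<otimes>\<^bsub>U\<^esub> gen h, 1) 1"
    by (simp add: vec_conv)
  also have "\<dots> = N +>\<^bsub>F\<^esub> Poly_Mapping.single (cls 1, \<chi> h * 1) 1"
    using gen_in_carrier[of h] assms Y_subset
    by (intro pure_eq in_R single_in_F closed_U u) auto
  also have "\<dots> = N +>\<^bsub>F\<^esub> Poly_Mapping.single (cls 1, 1) (\<chi> h)"
    by (intro pure_eq in_R single_in_F u)
  also have "\<dots> = vec (scale (\<chi> h) 1)"
    using vec_scale[OF one] smult_T[OF single_in_F[OF u, of 1 1], of "\<chi> h"] by (simp add: vec_conv)
  finally show ?thesis .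
qed

end

section \<open>Homomorphisms out of the induced module\<close>

text \<open>The hypotheses of the universal property: a representation on functions and a vector
  \<open>v0\<close> on which \<open>Y\<close> acts by \<open>\<chi>\<close>. The resulting
  homomorphism sends \<open>vec f\<close> to \<open>f\<close> applied to \<open>v0\<close>;
  \<open>vec_eq_imp_poly_op_eq\<close> says that this is well defined.\<close>

locale induced_line_rep = induced_line +
  fixes op :: "'a \<Rightarrow> ('b \<Rightarrow> complex) \<Rightarrow> 'b \<Rightarrow> complex" and v0 :: "'b \<Rightarrow> complex"
  assumes linear_op: "linear_op (op x)"
    and op_bracket: "x \<in> X \<Longrightarrow> y \<in> X \<Longrightarrow>
      op x (op y \<psi>) w - super_sign (d x) (d y) * op y (op x \<psi>) w = lin_ext (\<lambda>z. op z \<psi> w) (br x y)"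
    and op_v0: "h \<in> Y \<Longrightarrow> op h v0 w = \<chi> h * v0 w"
begin

text \<open>The elements acting as zero form a two-sided ideal, and \<open>op_bracket\<close> puts
  the defining relations into it. The ideal generated by the relations is the least one.\<close>

lemma poly_op_I:
  assumes "f \<in> I"
  shows "poly_op op f \<psi> w = 0"
proof -
  let ?J = "{f \<in> carrier A. \<forall>\<psi> w. poly_op op f \<psi> w = 0}"
  interpret Module.module complex_field A by (rule module_free_algebra)
  have "submodule ?J complex_field A"
    using closed_A
    by (intro complex_submoduleI[OF module_free_algebra])
       (auto simp: poly_op_simps simp del: free_algebra_simps(1))
  then have "subgroup ?J (add_monoid A)"
    by (rule submodule.axioms(1))
  moreover have zero: "poly_op op f (\<lambda>w. 0) = (\<lambda>w. 0)" for f
    using linear_op_zero[OF linear_op_poly_op] linear_op by blast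
  ultimately have "ideal ?J A"
    using closed_A
    by (intro idealI ring_free_algebra)
       (auto simp: poly_op_mult linear_op fun_eq_iff[symmetric] simp del: free_algebra_simps(1))
  moreover have "enveloping_relations X d br \<subseteq> ?J"
  proof
    fix r assume "r \<in> enveloping_relations X d br"
    then obtain x y where xy: "x \<in> X" "y \<in> X" and r: "r = rel x y"
      unfolding enveloping_relations_def by blast
    have "poly_op op r \<psi> w = 0" for \<psi> w
      using op_bracket[OF xy]
      by (simp add: r poly_op_simps poly_op_degree_one word_op_def)
    then show "r \<in> ?J"
      using relations_carrier[OF xy] r by blast
  qed
  ultimately have "I \<subseteq> ?J"
    unfolding enveloping_ideal_def by (rule ring.genideal_minimal[OF ring_free_algebra])
  then show ?thesis
    using assms by blast
qed

definition env_op :: "'a env \<Rightarrow> ('b \<Rightarrow> complex) \<Rightarrow> 'b \<Rightarrow> complex" where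
  "env_op u = poly_op op (SOME f. f \<in> carrier A \<and> u = cls f)"

text \<open>Two representatives of a class differ by an element of the ideal, which acts as zero, so
  the choice in \<open>env_op\<close> does not matter.\<close>

lemma env_op_cls:
  assumes "f \<in> carrier A"
  shows "env_op (cls f) \<psi> w = poly_op op f \<psi> w"
proof -
  define g where "g = (SOME g. g \<in> carrier A \<and> cls f = cls g)"
  have g: "g \<in> carrier A" "cls f = cls g"
    using someI[of "\<lambda>g. g \<in> carrier A \<and> cls f = cls g" f] assms by (auto simp: g_def)
  then have "f - g \<in> I"
    using cls_eq_iff assms free_algebra_minus by metis
  then show ?thesis
    unfolding env_op_def g_def[symmetric] using poly_op_I[of "f - g" \<psi> w]
    by (simp add: poly_op_simps)
qed

theorem vec_eq_imp_poly_op_eq: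
  assumes "vec f = vec g" "f \<in> carrier A" "g \<in> carrier A"
  shows "poly_op op f v0 w = poly_op op g v0 w"
proof -
  \<comment> \<open>Coordinate \<open>w\<close> of the homomorphism, lifted to the free space on
    pairs. It is enough that its kernel contains the tensor relations; \<open>op_v0\<close> takes
    care of balancing.\<close>
  let ?\<phi> = "\<lambda>r w. lin_ext (\<lambda>(u, m). m * env_op u v0 w) r"
  let ?M = "{r \<in> carrier F. \<forall>w. ?\<phi> r w = 0}"
  have "submodule ?M complex_field F"
    using closed_F
    by (intro complex_submoduleI[OF module_free_space])
       (auto simp: lin_ext_add lin_ext_scale simp del: free_space_simps(1))
  moreover have "R \<subseteq> ?M"
  proof
    fix r assume r: "r \<in> R"
    then have "?\<phi> r w = 0" for w
    proof (cases rule: R_cases)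
      case (add_left u u' m)
      then obtain f f' where "f \<in> carrier A" "u = cls f" "f' \<in> carrier A" "u' = cls f'"
        by (auto simp: carrier_U)
      then show ?thesis
        by (simp add: add_left(3) add_U lin_ext_diff env_op_cls poly_op_simps closed_A(1)
            distrib_left del: free_algebra_simps(1))
    next
      case (smult_left c u m)
      then obtain f where "f \<in> carrier A" "u = cls f"
        by (auto simp: carrier_U)
      then show ?thesis
        by (simp add: smult_left(2) smult_U lin_ext_diff env_op_cls poly_op_simps closed_A(4)
            del: free_algebra_simps(1))
    next
      case (add_right u m m')
      then show ?thesis
        by (simp only: add_right(2) lin_ext_diff lin_ext_single) (simp add: algebra_simps)
    next
      case (smult_right c u m)
      then show ?thesis
        by (simp only: smult_right(2) lin_ext_diff lin_ext_single) (simp add: algebra_simps)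
    next
      case (balanced u h m)
      then obtain f where f: "f \<in> carrier A" "u = cls f" by (auto simp: carrier_U)
      have h: "Poly_Mapping.single [h] 1 \<in> carrier A"
        using balanced Y_subset by (intro closed_A) auto
      have "poly_op op (Poly_Mapping.single [h] 1) v0 = (\<lambda>w. \<chi> h * v0 w)"
        using op_v0[OF balanced(2)] by (simp add: fun_eq_iff poly_op_simps word_op_def)
      then show ?thesis
        using f h linear_op_scale[OF linear_op_poly_op[of op f, OF linear_op], of "\<chi> h" v0]
        by (simp add: balanced(3) gen_conv_cls mult_U closed_A(3) lin_ext_diff env_op_cls
            poly_op_mult linear_op del: free_algebra_simps(1))
    qed
    then show "r \<in> ?M"
      using r R_subset by blast
  qed
  ultimately have "N \<subseteq> ?M"
    by (rule N_minimal)
  moreover have "Poly_Mapping.single (cls f, 1) 1 - Poly_Mapping.single (cls g, 1) 1 \<in> N"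
    using assms coset_eq_iff_diff[OF single_in_F single_in_F] cls_in_carrier unfolding vec_conv by blast
  ultimately show ?thesis
    using assms(2,3) by (auto simp: lin_ext_diff env_op_cls simp del: free_algebra_simps(1))
qed

end

section \<open>The induced module of q(n+1)\<close>

lemma q_bracket_closed:
  assumes "x \<in> q_basis n" "y \<in> q_basis n"
  shows "Poly_Mapping.keys (q_bracket x y) \<subseteq> q_basis n"
proof -
  obtain i j \<sigma> k l \<theta> where xy: "x = (i, j, \<sigma>)" "y = (k, l, \<theta>)"
    by (metis prod_cases3)
  show ?thesis
    using assms unfolding xy q_bracket.simps by (intro keys_diff_subset) (auto simp: q_basis_def)
qed

lemma linear_super_op: "linear_op (super_op x)"
  by (auto simp: linear_op_def super_op_add super_op_scale)

lemma super_op_q_bracket: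
  "super_op x (super_op y \<psi>) w - super_sign (q_parity x) (q_parity y) * super_op y (super_op x \<psi>) w
     = lin_ext (\<lambda>z. super_op z \<psi> w) (q_bracket x y)"
proof -
  obtain i j \<sigma> k l \<theta> where "x = (i, j, \<sigma>)" "y = (k, l, \<theta>)"
    by (metis prod_cases3)
  then show ?thesis
    using super_op_bracket[of i j \<sigma> k l \<theta> \<psi> w] by (simp add: lin_ext_diff)
qed

lemma line_act_eq: "line_act p = (\<lambda>h z. line_act p h 1 * z)"
proof (intro ext)
  show "line_act p h z = line_act p h 1 * z" for h z
    by (cases h) simp
qed

context
  fixes n p :: nat
begin

interpretation q: induced_line_rep "q_basis n" q_parity q_bracket "parabolic_basis n"
  "\<lambda>h. line_act p h 1" super_op "vac_wave p"
proof
  show "parabolic_basis n \<subseteq> q_basis n"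
    by (auto simp: parabolic_basis_def q_basis_def)
qed (use q_bracket_closed in \<open>auto simp only: linear_super_op super_op_q_bracket super_op_vac_wave\<close>)

section \<open>Vectors of \<open>Vbar\<close> as combinations of words applied to
  \<open>v\<^sub>0\<close>\<close>

definition mvec :: "(q_elt list \<Rightarrow>\<^sub>0 complex) \<Rightarrow> Vbar_elt" where
  "mvec = q.vec"

abbreviation "pols \<equiv> carrier (free_algebra (q_basis n))"
abbreviation "word_pol \<equiv> (\<lambda>u. Poly_Mapping.single u (1 :: complex) :: q_elt list \<Rightarrow>\<^sub>0 complex)"

lemma Vbar_conv: "Vbar n p = q.T"
  unfolding Vbar_def U_q_def gen_q_def[abs_def] by (subst line_act_eq) (rule refl)

lemma module_Vbar: "Module.module complex_field (Vbar n p)"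
  unfolding Vbar_conv by (rule q.module_T)

lemma vac_conv: "vac n p = mvec 1"
  unfolding vac_def mvec_def q.vec_def U_q_def gen_q_def[abs_def] q.one_U
  by (subst line_act_eq) (rule refl)

lemma act_mvec: "x \<in> q_basis n \<Longrightarrow> f \<in> pols \<Longrightarrow> act n p x (mvec f) = mvec (word_pol [x] * f)"
  unfolding act_def mvec_def U_q_def gen_q_def[abs_def]
  by (subst line_act_eq) (rule q.tact_vec)

lemma mvec_add: "f \<in> pols \<Longrightarrow> g \<in> pols \<Longrightarrow> mvec (f + g) = mvec f \<oplus>\<^bsub>Vbar n p\<^esub> mvec g"
  unfolding Vbar_conv mvec_def by (rule q.vec_add)

lemma mvec_scale: "f \<in> pols \<Longrightarrow> mvec (scale c f) = c \<odot>\<^bsub>Vbar n p\<^esub> mvec f"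
  unfolding Vbar_conv mvec_def by (rule q.vec_scale)

lemma mvec_in_carrier: "f \<in> pols \<Longrightarrow> mvec f \<in> carrier (Vbar n p)"
  unfolding Vbar_conv mvec_def by (rule q.vec_in_carrier)

lemma mvec_surj: "v \<in> carrier (Vbar n p) \<Longrightarrow> \<exists>f\<in>pols. v = mvec f"
  unfolding Vbar_conv mvec_def by (rule q.vec_surj)

lemmas mvec_relation = q.vec_relation[folded mvec_def]
  and mvec_line = q.vec_line[folded mvec_def]
  and pols_closed = q.closed_A
  and poly_op_wd = q.vec_eq_imp_poly_op_eq[folded mvec_def]

lemma word_pol_in_pols: "u \<in> lists (q_basis n) \<Longrightarrow> Poly_Mapping.single u c \<in> pols"
  by simp

lemma single_mult: "Poly_Mapping.single u a * Poly_Mapping.single w b = Poly_Mapping.single (u @ w) (a * b)"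
  for u w :: "q_elt list" and a b :: complex
  by (simp add: Poly_Mapping.mult_single plus_list_def)

lemmas submoduleD = complex_submoduleD[OF module_Vbar]

lemma mvec_zero: "mvec 0 = \<zero>\<^bsub>Vbar n p\<^esub>"
proof -
  interpret Module.module complex_field "Vbar n p" by (rule module_Vbar)
  show ?thesis
    using mvec_scale[OF pols_closed(6), of 0] smult_l_null[OF mvec_in_carrier[OF pols_closed(6)]]
    by simp
qed

lemma mvec_sum_in:
  assumes W: "submodule W complex_field (Vbar n p)" and "finite K"
    and "\<And>k. k \<in> K \<Longrightarrow> f k \<in> pols \<and> mvec (f k) \<in> W"
  shows "sum f K \<in> pols \<and> mvec (sum f K) \<in> W"
  using assms(2,3)
proof (induction K)
  case empty
  then show ?case
    using submoduleD(2)[OF W] pols_closed(6) by (simp only: mvec_zero sum.empty simp_thms)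
next
  case (insert k K)
  then have f: "f k \<in> pols" "mvec (f k) \<in> W" "sum f K \<in> pols" "mvec (sum f K) \<in> W"
    by blast+
  show ?case
    using pols_closed(1)[OF f(1,3)] submoduleD(3)[OF W f(2,4)]
    by (simp only: mvec_add[OF f(1,3)] sum.insert[OF insert(1,2)] simp_thms)
qed

lemma mvec_single_in:
  assumes W: "submodule W complex_field (Vbar n p)" and u: "u \<in> lists (q_basis n)"
    and "mvec (word_pol u) \<in> W"
  shows "mvec (Poly_Mapping.single u c) \<in> W"
  using submoduleD(4)[OF W assms(3), of c] unfolding mvec_scale[OF word_pol_in_pols[OF u], symmetric]
  by simp

lemma mvec_mult_in:
  assumes W: "submodule W complex_field (Vbar n p)" and f: "f \<in> pols" and x: "x \<in> lists (q_basis n)"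
    and xu: "\<And>u. u \<in> Poly_Mapping.keys f \<Longrightarrow> mvec (word_pol (x @ u)) \<in> W"
  shows "mvec (word_pol x * f) \<in> W"
proof -
  have "word_pol x * (\<Sum>u\<in>K. Poly_Mapping.single u (c u))
      = (\<Sum>u\<in>K. Poly_Mapping.single (x @ u) (c u))" for K and c :: "_ \<Rightarrow> complex"
    by (simp add: sum_distrib_left single_mult)
  from this[of "Poly_Mapping.lookup f" "Poly_Mapping.keys f"]
  have eq: "word_pol x * f = (\<Sum>u\<in>Poly_Mapping.keys f. Poly_Mapping.single (x @ u) (Poly_Mapping.lookup f u))"
    by (simp only: sum_single_lookup)
  show ?thesis
    unfolding eq
  proof (rule conjunct2[OF mvec_sum_in[OF W finite_keys]])
    fix u assume u: "u \<in> Poly_Mapping.keys f"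
    then have "x @ u \<in> lists (q_basis n)"
      using f x by auto
    then show "Poly_Mapping.single (x @ u) (Poly_Mapping.lookup f u) \<in> pols \<and>
        mvec (Poly_Mapping.single (x @ u) (Poly_Mapping.lookup f u)) \<in> W"
      by (auto simp only: word_pol_in_pols mvec_single_in[OF W _ xu[OF u]])
  qed
qed

lemma mvec_in:
  assumes W: "submodule W complex_field (Vbar n p)" and f: "f \<in> pols"
    and "\<And>u. u \<in> Poly_Mapping.keys f \<Longrightarrow> mvec (word_pol u) \<in> W"
  shows "mvec f \<in> W"
  using mvec_mult_in[OF W f, of "[]"] assms(3) zero_list_def[where 'a=q_elt] by simp

text \<open>Every vector is a combination of words applied to \<open>v\<^sub>0\<close>, and
  \<open>W\<close> is stable under each letter. This serves both to show that a submodule is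
  everything and to keep \<open>v\<^sub>0\<close> out of proper submodules.\<close>

lemma submodule_generated_by_vac:
  assumes "q_submodule n p W" "vac n p \<in> W"
  shows "W = carrier (Vbar n p)"
proof
  have W: "submodule W complex_field (Vbar n p)"
    using assms(1) by (simp add: q_submodule_def)
  show "W \<subseteq> carrier (Vbar n p)"
    by (rule submoduleD(1)[OF W])
  have word: "mvec (word_pol u) \<in> W" if "u \<in> lists (q_basis n)" for u
    using that
  proof (induction u)
    case Nil
    have "word_pol [] = 1"
      by (simp add: zero_list_def[symmetric])
    then show ?case
      using assms(2) by (simp only: vac_conv)
  next
    case (Cons x u)
    have "act n p x (mvec (word_pol u)) \<in> W"
      using assms(1) Cons unfolding q_submodule_def by blast
    then show ?case
      unfolding act_mvec[OF Cons(1) word_pol_in_pols[OF Cons(2)]] by (simp add: single_mult)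
  qed
  show "carrier (Vbar n p) \<subseteq> W"
  proof
    fix v assume "v \<in> carrier (Vbar n p)"
    then obtain f where f: "f \<in> pols" "v = mvec f"
      using mvec_surj by blast
    then have "mvec (word_pol u) \<in> W" if "u \<in> Poly_Mapping.keys f" for u
      using that by (intro word) auto
    then show "v \<in> W"
      unfolding f(2) by (rule mvec_in[OF W f(1)])
  qed
qed

section \<open>Spanning by words in the raising elements\<close>

definition raising :: "q_elt set" where
  "raising = b_plus ` {1..n} \<union> f_plus ` {1..n}"

definition raising_pols :: "(q_elt list \<Rightarrow>\<^sub>0 complex) set" where
  "raising_pols = {f. Poly_Mapping.keys f \<subseteq> lists raising}"

lemma q_basis_cases: "q_basis n = parabolic_basis n \<union> raising"
proof -
  have "x \<in> q_basis n \<longleftrightarrow> x \<in> parabolic_basis n \<union> raising" for x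
  proof -
    obtain i j \<sigma> where "x = (i, j, \<sigma>)" by (cases x)
    then show ?thesis
      by (cases \<sigma>) (auto simp: q_basis_def parabolic_basis_def raising_def image_iff)
  qed
  then show ?thesis by blast
qed

lemma raising_subset: "raising \<subseteq> q_basis n"
  using q_basis_cases by blast

lemma lists_raising: "u \<in> lists raising \<Longrightarrow> u \<in> lists (q_basis n)"
  using raising_subset lists_mono by blast

lemma raising_pols_subset: "raising_pols \<subseteq> pols"
  using lists_mono[OF raising_subset] by (auto simp: raising_pols_def)

lemma raising_pols_closed:
  "f \<in> raising_pols \<Longrightarrow> g \<in> raising_pols \<Longrightarrow> f + g \<in> raising_pols"
  "f \<in> raising_pols \<Longrightarrow> scale c f \<in> raising_pols"
  "f \<in> raising_pols \<Longrightarrow> g \<in> raising_pols \<Longrightarrow> f * g \<in> raising_pols"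
  "u \<in> lists raising \<Longrightarrow> Poly_Mapping.single u c \<in> raising_pols"
  "1 \<in> raising_pols"
  by (simp_all add: zero_list_def raising_pols_def keys_add_subset keys_scale_subset keys_mult_lists)

lemma submodule_raising: "submodule (mvec ` raising_pols) complex_field (Vbar n p)"
proof (rule complex_submoduleI[OF module_Vbar])
  show "mvec ` raising_pols \<subseteq> carrier (Vbar n p)"
    using mvec_in_carrier raising_pols_subset by blast
  show "\<zero>\<^bsub>Vbar n p\<^esub> \<in> mvec ` raising_pols"
    unfolding mvec_zero[symmetric] by (intro imageI) (simp add: raising_pols_def)
  fix x y assume "x \<in> mvec ` raising_pols" "y \<in> mvec ` raising_pols"
  then obtain f g where fg: "f \<in> raising_pols" "g \<in> raising_pols" and xy: "x = mvec f" "y = mvec g"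
    by blast
  have A: "f \<in> pols" "g \<in> pols"
    using fg raising_pols_subset by blast+
  show "x \<oplus>\<^bsub>Vbar n p\<^esub> y \<in> mvec ` raising_pols"
    using raising_pols_closed(1)[OF fg] by (simp only: xy mvec_add[OF A, symmetric] imageI)
  show "c \<odot>\<^bsub>Vbar n p\<^esub> x \<in> mvec ` raising_pols" for c
    using raising_pols_closed(2)[OF fg(1)] by (simp only: xy mvec_scale[OF A(1), symmetric] imageI)
qed

lemma mvec_relation_word:
  assumes "x \<in> q_basis n" "y \<in> q_basis n" "u \<in> lists (q_basis n)"
  shows "mvec (word_pol (x # y # u)) = mvec (Poly_Mapping.single (y # x # u) (super_sign (q_parity x) (q_parity y))
     + (\<Sum>z\<in>Poly_Mapping.keys (q_bracket x y). Poly_Mapping.single (z # u) (Poly_Mapping.lookup (q_bracket x y) z)))"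
  using mvec_relation[OF assms(1,2) word_pol_in_pols[OF assms(3), of 1]]
  by (simp add: single_mult degree_one_def sum_distrib_right)

text \<open>A letter that is not raising lies in the parabolic part. It moves to the right past each
  raising letter, leaving bracket terms on a shorter word, until it meets \<open>v\<^sub>0\<close>
  and becomes a scalar. The bracket may produce any basis element, hence the induction over all
  \<open>x\<close> at once.\<close>

lemma act_raising_word:
  assumes "u \<in> lists raising" "x \<in> q_basis n"
  shows "mvec (word_pol (x # u)) \<in> mvec ` raising_pols"
  using assms
proof (induction u arbitrary: x)
  case Nil
  show ?case
  proof (cases "x \<in> raising")
    case True
    then show ?thesis
      by (intro imageI raising_pols_closed) auto
  next
    case False
    then have "mvec (word_pol [x]) = mvec (scale (line_act p x 1) 1)"
      using mvec_line[of x] Nil q_basis_cases by blast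
    then show ?thesis
      using raising_pols_closed(2)[OF raising_pols_closed(5)] by simp
  qed
next
  case (Cons y u)
  note W = submodule_raising
  show ?case
  proof (cases "x \<in> raising")
    case True
    then show ?thesis
      using Cons.hyps by (intro imageI raising_pols_closed) auto
  next
    case False
    have y: "y \<in> q_basis n" and u: "u \<in> lists (q_basis n)"
      using Cons.hyps raising_subset lists_raising by auto
    let ?s = "Poly_Mapping.single (y # x # u) (super_sign (q_parity x) (q_parity y))"
    let ?S = "\<Sum>z\<in>Poly_Mapping.keys (q_bracket x y). Poly_Mapping.single (z # u) (Poly_Mapping.lookup (q_bracket x y) z)"
    \<comment> \<open>The word \<open>x # u\<close> need not be raising. It is replaced by the
      combination \<open>g\<close> of raising words, to which the raising letter \<open>y\<close>
      can be prepended.\<close>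
    obtain g where g: "g \<in> raising_pols" "mvec (word_pol (x # u)) = mvec g"
      using Cons.IH[OF Cons.prems] by blast
    have xu: "x # u \<in> lists (q_basis n)" and yxu: "y # x # u \<in> lists (q_basis n)"
      using Cons.prems u y by auto
    have "word_pol [y] * g \<in> raising_pols"
      using Cons.hyps g by (intro raising_pols_closed) auto
    moreover have "mvec (word_pol (y # x # u)) = act n p y (mvec (word_pol (x # u)))"
      using act_mvec[OF y word_pol_in_pols[OF xu]] by (simp add: single_mult)
    moreover have "act n p y (mvec g) = mvec (word_pol [y] * g)"
      using act_mvec[OF y] g raising_pols_subset by blast
    ultimately have 1: "mvec ?s \<in> mvec ` raising_pols"
      using g(2) mvec_single_in[OF W yxu] by simp
    have 2: "?S \<in> pols \<and> mvec ?S \<in> mvec ` raising_pols"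
    proof (rule mvec_sum_in[OF W finite_keys])
      fix z assume "z \<in> Poly_Mapping.keys (q_bracket x y)"
      then have z: "z \<in> q_basis n"
        using q_bracket_closed Cons.prems y by blast
      then have zu: "z # u \<in> lists (q_basis n)"
        using u by auto
      then show "Poly_Mapping.single (z # u) (Poly_Mapping.lookup (q_bracket x y) z) \<in> pols \<and>
          mvec (Poly_Mapping.single (z # u) (Poly_Mapping.lookup (q_bracket x y) z)) \<in> mvec ` raising_pols"
        using mvec_single_in[OF W zu Cons.IH[OF z]] word_pol_in_pols by blast
    qed
    have "mvec (?s + ?S) = mvec ?s \<oplus>\<^bsub>Vbar n p\<^esub> mvec ?S"
      using 2 word_pol_in_pols[OF yxu] by (intro mvec_add) auto
    then show ?thesis
      unfolding mvec_relation_word[OF Cons.prems y u]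
      using submoduleD(3)[OF W 1] 2 by simp
  qed
qed

text \<open>By \<open>act_raising_word\<close> the span of the raising words is stable under all of
  \<open>q(n+1)\<close>, and it contains \<open>v\<^sub>0\<close>, which generates the
  module.\<close>

lemma Vbar_raising: "carrier (Vbar n p) = mvec ` raising_pols"
proof (rule submodule_generated_by_vac[symmetric])
  show "vac n p \<in> mvec ` raising_pols"
    unfolding vac_conv by (intro imageI) (simp add: raising_pols_def zero_list_def)
  show "q_submodule n p (mvec ` raising_pols)"
    unfolding q_submodule_def
  proof (intro conjI ballI submodule_raising)
    fix x v assume x: "x \<in> q_basis n" and "v \<in> mvec ` raising_pols"
    then obtain f where f: "f \<in> raising_pols" "v = mvec f" by blast
    then have fA: "f \<in> pols"
      using raising_pols_subset by blast
    have "mvec (word_pol ([x] @ u)) \<in> mvec ` raising_pols" if "u \<in> Poly_Mapping.keys f" for u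
      using act_raising_word[OF _ x] that f(1) by (auto simp: raising_pols_def)
    then show "act n p x v \<in> mvec ` raising_pols"
      unfolding f(2) act_mvec[OF x fA]
      using x by (intro mvec_mult_in submodule_raising fA) auto
  qed
qed

section \<open>Weights and proper submodules\<close>

text \<open>The even \<open>(0, 0, 0)\<close> has eigenvalue \<open>p\<close> on
  \<open>v\<^sub>0\<close>, and its bracket with a raising element \<open>y\<close> is
  \<open>-y\<close>, so every raising letter lowers the eigenvalue by one.\<close>

lemma weight_word:
  assumes "u \<in> lists raising"
  shows "mvec (word_pol ((0, 0, 0) # u)) = mvec (Poly_Mapping.single u (of_nat p - of_nat (length u)))"
  using assms
proof (induction u)
  case Nil
  have "(0, 0, 0) \<in> parabolic_basis n"
    by (simp add: parabolic_basis_def)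
  from mvec_line[OF this] show ?case
    by (simp add: zero_list_def single_one[symmetric] del: single_one)
next
  case (Cons y u)
  obtain i \<sigma> where y: "y = (i, 0, \<sigma>)" "i \<noteq> 0"
    using Cons.hyps by (auto simp: raising_def)
  have y': "y \<in> q_basis n" and u: "u \<in> lists (q_basis n)" and e: "(0, 0, 0) \<in> q_basis n"
    using Cons raising_subset lists_raising by (auto simp: q_basis_def)
  let ?e = "(0, 0, 0) :: q_elt"
  have br: "q_bracket ?e y = Poly_Mapping.single y (-1)"
    by (simp add: y super_sign_def single_uminus)
  have "mvec (word_pol (?e # y # u)) = mvec (word_pol (y # ?e # u) + Poly_Mapping.single (y # u) (-1))"
    using mvec_relation_word[OF e y' u] unfolding br by (simp add: super_sign_def)
  also have "\<dots> = mvec (word_pol (y # ?e # u)) \<oplus>\<^bsub>Vbar n p\<^esub> mvec (Poly_Mapping.single (y # u) (-1))"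
    using y' u e by (intro mvec_add word_pol_in_pols) auto
  also have "mvec (word_pol (y # ?e # u)) = act n p y (mvec (word_pol (?e # u)))"
    using act_mvec[OF y' word_pol_in_pols, of "?e # u" 1] u e by (simp add: single_mult)
  also have "\<dots> = act n p y (mvec (Poly_Mapping.single u (of_nat p - of_nat (length u))))"
    by (simp only: Cons.IH)
  also have "\<dots> = mvec (Poly_Mapping.single (y # u) (of_nat p - of_nat (length u)))"
    using act_mvec[OF y' word_pol_in_pols[OF u]] by (simp add: single_mult)
  also have "\<dots> \<oplus>\<^bsub>Vbar n p\<^esub> mvec (Poly_Mapping.single (y # u) (-1))
      = mvec (Poly_Mapping.single (y # u) (of_nat p - of_nat (length u)) + Poly_Mapping.single (y # u) (-1))"
    using y' u by (intro mvec_add[symmetric] word_pol_in_pols) auto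
  finally show ?case
    by (simp add: single_add[symmetric] algebra_simps)
qed

lemma mvec_sum_cong:
  assumes "finite K"
    and "\<And>k. k \<in> K \<Longrightarrow> g k \<in> pols \<and> h k \<in> pols \<and> mvec (g k) = mvec (h k)"
  shows "sum g K \<in> pols \<and> sum h K \<in> pols \<and> mvec (sum g K) = mvec (sum h K)"
  using assms
proof (induction K)
  case empty
  then show ?case
    by simp
next
  case (insert k K)
  then have f: "g k \<in> pols" "h k \<in> pols" "mvec (g k) = mvec (h k)"
    "sum g K \<in> pols" "sum h K \<in> pols" "mvec (sum g K) = mvec (sum h K)"
    by blast+
  show ?case
    unfolding sum.insert[OF insert(1,2)] mvec_add[OF f(1,4)] mvec_add[OF f(2,5)] f(3,6)
    using pols_closed(1)[OF f(1,4)] pols_closed(1)[OF f(2,5)] by blast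
qed

text \<open>Stated for a representative \<open>f\<close>, which the vector \<open>mvec f\<close> is
  not known to determine. The weight operator is thereby realised by rescaling the coefficients of
  \<open>f\<close>.\<close>

lemma act_weight:
  assumes f: "f \<in> raising_pols"
  shows "act n p (0, 0, 0) (mvec f) = mvec (\<Sum>u\<in>Poly_Mapping.keys f.
    Poly_Mapping.single u ((of_nat p - of_nat (length u)) * Poly_Mapping.lookup f u))"
proof -
  let ?e = "(0, 0, 0) :: q_elt"
  have e: "?e \<in> q_basis n"
    by (simp add: q_basis_def)
  have fA: "f \<in> pols"
    using f raising_pols_subset by blast
  have "word_pol [?e] * (\<Sum>u\<in>K. Poly_Mapping.single u (c u))
      = (\<Sum>u\<in>K. Poly_Mapping.single (?e # u) (c u))" for K and c :: "_ \<Rightarrow> complex"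
    by (simp add: sum_distrib_left single_mult)
  from this[of "Poly_Mapping.lookup f" "Poly_Mapping.keys f"]
  have eq: "word_pol [?e] * f = (\<Sum>u\<in>Poly_Mapping.keys f. Poly_Mapping.single (?e # u) (Poly_Mapping.lookup f u))"
    by (simp only: sum_single_lookup)
  show ?thesis
    unfolding act_mvec[OF e fA] eq
  proof (rule mvec_sum_cong[THEN conjunct2, THEN conjunct2, OF finite_keys])
    fix u assume "u \<in> Poly_Mapping.keys f"
    then have u: "u \<in> lists raising"
      using f by (auto simp: raising_pols_def)
    have uA: "?e # u \<in> lists (q_basis n)" "u \<in> lists (q_basis n)"
      using e lists_raising[OF u] by auto
    let ?c = "Poly_Mapping.lookup f u"
    have "mvec (Poly_Mapping.single (?e # u) ?c) = ?c \<odot>\<^bsub>Vbar n p\<^esub> mvec (word_pol (?e # u))"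
      using mvec_scale[OF word_pol_in_pols[OF uA(1)], of ?c 1] by simp
    also have "\<dots> = mvec (Poly_Mapping.single u ((of_nat p - of_nat (length u)) * ?c))"
      unfolding weight_word[OF u] mvec_scale[OF word_pol_in_pols[OF uA(2)], symmetric]
      by (simp add: mult.commute)
    finally show "Poly_Mapping.single (?e # u) ?c \<in> pols \<and>
        Poly_Mapping.single u ((of_nat p - of_nat (length u)) * ?c) \<in> pols \<and>
        mvec (Poly_Mapping.single (?e # u) ?c) =
        mvec (Poly_Mapping.single u ((of_nat p - of_nat (length u)) * ?c))"
      using word_pol_in_pols uA by blast
  qed
qed

text \<open>Words of maximal length are removed by the weight operator minus their eigenvalue, which
  keeps the vector in \<open>W\<close> and multiplies the coefficient of the empty word by a nonzero
  number. When only the empty word is left, a nonzero coefficient would put \<open>v\<^sub>0\<close>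
  into \<open>W\<close>.\<close>

lemma proper_submodule_vac_coeff:
  assumes W: "q_submodule n p W" "W \<noteq> carrier (Vbar n p)"
    and "f \<in> raising_pols" "mvec f \<in> W"
  shows "Poly_Mapping.lookup f [] = 0"
proof -
  note sub = W(1)[unfolded q_submodule_def, THEN conjunct1]
  have "Poly_Mapping.lookup f [] = 0"
    if "f \<in> raising_pols" "mvec f \<in> W" "\<And>u. u \<in> Poly_Mapping.keys f \<Longrightarrow> length u \<le> K" for K f
    using that
  proof (induction K arbitrary: f)
    case 0
    then have "Poly_Mapping.keys f \<subseteq> {[]}" by auto
    then have f: "f = scale (Poly_Mapping.lookup f []) 1"
      by (intro poly_mapping_eqI) (auto simp: lookup_one zero_list_def when_def in_keys_iff)
    show ?case
    proof (rule ccontr)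
      assume c: "Poly_Mapping.lookup f [] \<noteq> 0"
      have "mvec (scale (1 / Poly_Mapping.lookup f []) f) \<in> W"
        using 0 raising_pols_subset mvec_scale[of f] submoduleD(4)[OF sub] by auto
      moreover have "scale (1 / Poly_Mapping.lookup f []) f = 1"
        using c by (subst f) (simp add: scale_simps(3)[symmetric] scale_simps(4))
      ultimately have "vac n p \<in> W"
        by (simp add: vac_conv)
      then show False
        using submodule_generated_by_vac W by blast
    qed
  next
    case (Suc K)
    have fA: "f \<in> pols"
      using Suc.prems raising_pols_subset by blast
    let ?c = "\<lambda>a u. (a - of_nat (length u)) * Poly_Mapping.lookup f u"
    \<comment> \<open>By \<open>act_weight\<close>, \<open>D p\<close> represents the weight
      operator applied to \<open>mvec f\<close>, while \<open>D (Suc K)\<close> contains no word of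
      length \<open>Suc K\<close>.\<close>
    define D where "D a = (\<Sum>u\<in>Poly_Mapping.keys f. Poly_Mapping.single u (?c a u))" for a :: complex
    have lookup_D: "Poly_Mapping.lookup (D a) u = ?c a u" for a u
      by (auto simp: D_def lookup_sum lookup_single when_def in_keys_iff)
    have D_in: "D a \<in> raising_pols" for a
      using Suc.prems(1) by (auto simp: raising_pols_def in_keys_iff lookup_D)
    have e: "(0, 0, 0) \<in> q_basis n"
      by (simp add: q_basis_def)
    \<comment> \<open>Both summands on the right represent vectors of \<open>W\<close>: the image of
      \<open>mvec f\<close> under the weight operator and a multiple of
      \<open>mvec f\<close>.\<close>
    have "D (of_nat (Suc K)) = D (of_nat p) + scale (of_nat (Suc K) - of_nat p) f"
      by (intro poly_mapping_eqI) (simp add: lookup_D lookup_add algebra_simps)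
    moreover have "mvec (D (of_nat p)) \<in> W"
      using W(1) e Suc.prems(2) unfolding q_submodule_def act_weight[OF Suc.prems(1), folded D_def, symmetric]
      by blast
    moreover have "mvec (scale (of_nat (Suc K) - of_nat p) f) \<in> W"
      unfolding mvec_scale[OF fA] by (rule submoduleD(4)[OF sub Suc.prems(2)])
    moreover have "D (of_nat p) \<in> pols"
      using D_in raising_pols_subset by blast
    ultimately have "mvec (D (of_nat (Suc K))) \<in> W"
      using mvec_add[of "D (of_nat p)"] pols_closed(4)[OF fA] submoduleD(3)[OF sub] by presburger
    moreover have "length u \<le> K" if "u \<in> Poly_Mapping.keys (D (of_nat (Suc K)))" for u
    proof -
      have "length u \<noteq> Suc K" "u \<in> Poly_Mapping.keys f"
        using that by (auto simp: in_keys_iff lookup_D)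
      then show ?thesis
        using Suc.prems(3)[of u] by linarith
    qed
    ultimately have "Poly_Mapping.lookup (D (of_nat (Suc K))) [] = 0"
      using D_in by (intro Suc.IH)
    \<comment> \<open>The empty word has length 0, so its coefficient has been multiplied by
      \<open>Suc K\<close>, which is nonzero.\<close>
    then show ?case
      unfolding lookup_D by (simp del: of_nat_Suc)
  qed
  from this[OF assms(3,4), of "Max (length ` Poly_Mapping.keys f)"] show ?thesis
    by simp
qed

section \<open>The inner product pulled back to the induced module\<close>

definition wave_of :: "(q_elt list \<Rightarrow>\<^sub>0 complex) \<Rightarrow> wave" where
  "wave_of f = poly_op super_op f (vac_wave p)"

definition vac_norm :: complex where
  "vac_norm = wave_inner n p (vac_wave p) (vac_wave p)"

text \<open>The homomorphism from the induced module to the tensor power. The chosen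
  \<open>f\<close> does not matter, by \<open>poly_op_wd\<close>.\<close>

definition vec_wave :: "Vbar_elt \<Rightarrow> wave" where
  "vec_wave v = wave_of (SOME f. f \<in> pols \<and> v = mvec f)"

text \<open>The division normalises the value at \<open>v\<^sub>0\<close> to 1.\<close>

definition wave_form :: "Vbar_elt \<Rightarrow> Vbar_elt \<Rightarrow> complex" where
  "wave_form v w = wave_inner n p (vec_wave v) (vec_wave w) / vac_norm"

lemma vec_wave_mvec: "f \<in> pols \<Longrightarrow> vec_wave (mvec f) = wave_of f"
proof -
  assume f: "f \<in> pols"
  define g where "g = (SOME g. g \<in> pols \<and> mvec f = mvec g)"
  have g: "g \<in> pols" "mvec f = mvec g"
    using someI[of "\<lambda>g. g \<in> pols \<and> mvec f = mvec g" f] f by (auto simp: g_def)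
  show ?thesis
    unfolding vec_wave_def g_def[symmetric]
    by (rule ext) (simp add: wave_of_def poly_op_wd[OF g(2) f g(1)])
qed

lemma vec_wave_add:
  assumes "v \<in> carrier (Vbar n p)" "w \<in> carrier (Vbar n p)"
  shows "vec_wave (v \<oplus>\<^bsub>Vbar n p\<^esub> w) = (\<lambda>x. vec_wave v x + vec_wave w x)"
proof -
  obtain f g where fg: "f \<in> pols" "g \<in> pols" and vw: "v = mvec f" "w = mvec g"
    using assms mvec_surj by meson
  show ?thesis
    unfolding vw mvec_add[OF fg, symmetric] vec_wave_mvec[OF pols_closed(1)[OF fg]]
      vec_wave_mvec[OF fg(1)] vec_wave_mvec[OF fg(2)]
    by (simp add: wave_of_def poly_op_simps fun_eq_iff)
qed

lemma vec_wave_smult: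
  assumes "v \<in> carrier (Vbar n p)"
  shows "vec_wave (c \<odot>\<^bsub>Vbar n p\<^esub> v) = (\<lambda>x. c * vec_wave v x)"
proof -
  obtain f where f: "f \<in> pols" and v: "v = mvec f"
    using assms mvec_surj by meson
  show ?thesis
    unfolding v mvec_scale[OF f, symmetric] vec_wave_mvec[OF pols_closed(4)[OF f]] vec_wave_mvec[OF f]
    by (simp add: wave_of_def poly_op_simps fun_eq_iff)
qed

lemma act_in_carrier:
  assumes "x \<in> q_basis n" "v \<in> carrier (Vbar n p)"
  shows "act n p x v \<in> carrier (Vbar n p)"
proof -
  obtain f where f: "f \<in> pols" and v: "v = mvec f"
    using assms mvec_surj by meson
  show ?thesis
    unfolding v act_mvec[OF assms(1) f]
    using mvec_in_carrier pols_closed(3)[OF pols_closed(5)[OF assms(1)] f] by blast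
qed

lemma vec_wave_act:
  assumes "x \<in> q_basis n" "v \<in> carrier (Vbar n p)"
  shows "vec_wave (act n p x v) = super_op x (vec_wave v)"
proof -
  obtain f where f: "f \<in> pols" and v: "v = mvec f"
    using assms mvec_surj by meson
  show ?thesis
    unfolding v act_mvec[OF assms(1) f] vec_wave_mvec[OF f]
      vec_wave_mvec[OF pols_closed(3)[OF pols_closed(5)[OF assms(1)] f]]
    by (simp add: wave_of_def poly_op_mult linear_super_op poly_op_simps word_op_def fun_eq_iff)
qed

lemma vec_wave_vac: "vec_wave (vac n p) = vac_wave p"
proof -
  have one: "1 = word_pol []"
    by (simp add: zero_list_def[symmetric])
  have "wave_of 1 w = vac_wave p w" for w
    unfolding wave_of_def one poly_op_simps word_op_def by simp
  then show ?thesis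
    unfolding vac_conv vec_wave_mvec[OF pols_closed(7)] by blast
qed

text \<open>Inherited from \<open>super_op_adjoint\<close> through the homomorphism. It covers all
  basis elements, not only those in the definition of a contravariant form, and so makes the radical
  stable under the whole algebra.\<close>

lemma wave_form_adjoint:
  assumes "i \<le> n" "j \<le> n" "v \<in> carrier (Vbar n p)" "w \<in> carrier (Vbar n p)"
  shows "wave_form (act n p (i, j, \<sigma>) v) w = wave_form v (act n p (j, i, \<sigma>) w)"
  using assms super_op_adjoint[OF assms(1,2)]
  by (simp add: wave_form_def vec_wave_act q_basis_def)

lemma vac_in_carrier: "vac n p \<in> carrier (Vbar n p)"
  unfolding vac_conv by (rule mvec_in_carrier[OF pols_closed(7)])

lemma vac_norm_real: "vac_norm = complex_of_real (Re vac_norm)" "cnj vac_norm = vac_norm"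
proof -
  show "cnj vac_norm = vac_norm"
    unfolding vac_norm_def by (rule wave_inner_commute[symmetric])
  then show "vac_norm = complex_of_real (Re vac_norm)"
    by (simp add: complex_eq_iff)
qed

lemma wave_form_contravariant:
  assumes "p \<ge> 1"
  shows "contravariant_form n p wave_form"
proof -
  have "vac_norm \<noteq> 0"
    using vac_wave_pos[OF assms, of n] by (auto simp: vac_norm_def)
  then have "wave_form (vac n p) (vac n p) = 1"
    by (simp add: wave_form_def vec_wave_vac vac_norm_def)
  moreover have "hermitian_form (Vbar n p) wave_form"
    unfolding hermitian_form_def
  proof (intro conjI ballI allI)
    show "wave_form w v = cnj (wave_form v w)" for v w
      using wave_inner_commute[of n p "vec_wave w" "vec_wave v"]
      by (simp add: wave_form_def vac_norm_real(2))
  qed (simp_all add: wave_form_def vec_wave_add vec_wave_smult wave_inner_add_right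
      wave_inner_scale_right add_divide_distrib)
  ultimately show ?thesis
    by (auto simp: contravariant_form_def wave_form_adjoint)
qed

section \<open>Uniqueness of the contravariant form\<close>

lemma hermitianD:
  assumes "hermitian_form (Vbar n p) H" "v \<in> carrier (Vbar n p)" "w \<in> carrier (Vbar n p)"
  shows "w' \<in> carrier (Vbar n p) \<Longrightarrow> H v (w \<oplus>\<^bsub>Vbar n p\<^esub> w') = H v w + H v w'"
    and "H v (c \<odot>\<^bsub>Vbar n p\<^esub> w) = c * H v w"
    and "H w v = cnj (H v w)"
  using assms unfolding hermitian_form_def by blast+

lemma form_zero_right:
  assumes "hermitian_form (Vbar n p) H" "v \<in> carrier (Vbar n p)"
  shows "H v (mvec 0) = 0"
  using hermitianD(2)[OF assms mvec_in_carrier[OF pols_closed(6)], of 0]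
  unfolding mvec_scale[OF pols_closed(6), symmetric] by simp

lemma form_expand:
  assumes H: "hermitian_form (Vbar n p) H" and v: "v \<in> carrier (Vbar n p)" and f: "f \<in> pols"
  shows "H v (mvec f) = lin_ext (\<lambda>u. H v (mvec (word_pol u))) f"
proof -
  have "(\<Sum>u\<in>K. Poly_Mapping.single u (c u)) \<in> pols \<and>
      H v (mvec (\<Sum>u\<in>K. Poly_Mapping.single u (c u))) = (\<Sum>u\<in>K. c u * H v (mvec (word_pol u)))"
    if "finite K" "K \<subseteq> lists (q_basis n)" for K and c :: "_ \<Rightarrow> complex"
    using that
  proof (induction K)
    case empty
    then show ?case
      using form_zero_right[OF H v] pols_closed(6) by simp
  next
    case (insert u K)
    let ?r = "\<Sum>u\<in>K. Poly_Mapping.single u (c u)"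
    have u: "Poly_Mapping.single u a \<in> pols" for a
      using insert by (intro word_pol_in_pols) auto
    have r: "?r \<in> pols" "H v (mvec ?r) = (\<Sum>u\<in>K. c u * H v (mvec (word_pol u)))"
      using insert by blast+
    have "H v (mvec (Poly_Mapping.single u (c u))) = c u * H v (mvec (word_pol u))"
      using hermitianD(2)[OF H v mvec_in_carrier[OF u], of "c u" 1]
      unfolding mvec_scale[OF u, symmetric] by simp
    then have "H v (mvec (Poly_Mapping.single u (c u) + ?r))
        = c u * H v (mvec (word_pol u)) + (\<Sum>u\<in>K. c u * H v (mvec (word_pol u)))"
      unfolding mvec_add[OF u r(1)]
      using hermitianD(1)[OF H v mvec_in_carrier[OF u] mvec_in_carrier[OF r(1)]] r(2) by simp
    then show ?case
      using pols_closed(1)[OF u r(1)] unfolding sum.insert[OF insert(1,2)] by blast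
  qed
  from this[of "Poly_Mapping.keys f" "Poly_Mapping.lookup f"] f show ?thesis
    by (simp add: sum_single_lookup lin_ext_def)
qed

text \<open>Transposition of matrix indices. On raising letters it gives the adjoint with respect to
  any contravariant form.\<close>

fun dual :: "q_elt \<Rightarrow> q_elt" where
  "dual (i, j, \<sigma>) = (j, i, \<sigma>)"

lemma dual_raising:
  assumes "x \<in> raising"
  shows "dual x \<in> parabolic_basis n" "dual x \<in> q_basis n" "line_act p (dual x) 1 = 0"
  using assms by (auto simp: raising_def parabolic_basis_def q_basis_def)

lemma contravariant_adjoint:
  assumes "contravariant_form n p H" "x \<in> raising" "v \<in> carrier (Vbar n p)" "w \<in> carrier (Vbar n p)"
  shows "H (act n p x v) w = H v (act n p (dual x) w)"
  using assms by (auto simp: contravariant_form_def raising_def)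

lemma act_dual_vac:
  assumes "x \<in> raising"
  shows "act n p (dual x) (vac n p) = mvec 0"
  using act_mvec[OF dual_raising(2)[OF assms] pols_closed(7)] mvec_line[OF dual_raising(1)[OF assms]]
    dual_raising(3)[OF assms]
  by (simp add: vac_conv)

lemma mvec_Cons:
  assumes "x \<in> q_basis n" "u \<in> lists (q_basis n)"
  shows "mvec (word_pol (x # u)) = act n p x (mvec (word_pol u))"
  using act_mvec[OF assms(1) word_pol_in_pols[OF assms(2)]] by (simp add: single_mult)

lemma mvec_Nil: "mvec (word_pol []) = vac n p"
  unfolding vac_conv by (simp add: zero_list_def[symmetric])

lemma mvec_word_in_carrier: "u \<in> lists raising \<Longrightarrow> mvec (word_pol u) \<in> carrier (Vbar n p)"
  by (rule mvec_in_carrier[OF word_pol_in_pols[OF lists_raising]])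

text \<open>A raising letter in one argument moves to the other as its dual, which annihilates
  \<open>v\<^sub>0\<close>. Only the empty word contributes, whatever the contravariant
  form.\<close>

lemma form_vac:
  assumes H: "contravariant_form n p H" and f: "f \<in> raising_pols"
  shows "H (vac n p) (mvec f) = Poly_Mapping.lookup f []"
proof -
  have herm: "hermitian_form (Vbar n p) H" and one: "H (vac n p) (vac n p) = 1"
    using H by (auto simp: contravariant_form_def)
  have "H (vac n p) (mvec (word_pol u)) = (1 when u = [])" if "u \<in> lists raising" for u
    using that
  proof (cases rule: lists.cases)
    case Nil
    then show ?thesis
      using one mvec_Nil by simp
  next
    case (Cons x u')
    note x = subsetD[OF raising_subset Cons(2)]
    have "H (mvec (word_pol u)) (vac n p) = H (mvec (word_pol u')) (act n p (dual x) (vac n p))"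
      unfolding Cons(1) mvec_Cons[OF x lists_raising[OF Cons(3)]]
      by (rule contravariant_adjoint[OF H Cons(2) mvec_word_in_carrier[OF Cons(3)] vac_in_carrier])
    also have "\<dots> = 0"
      unfolding act_dual_vac[OF Cons(2)]
      by (rule form_zero_right[OF herm mvec_word_in_carrier[OF Cons(3)]])
    finally show ?thesis
      using hermitianD(3)[OF herm mvec_word_in_carrier[OF that] vac_in_carrier] Cons(1) by simp
  qed
  then have "lin_ext (\<lambda>u. H (vac n p) (mvec (word_pol u))) f = lin_ext (\<lambda>u. 1 when u = []) f"
    using f unfolding lin_ext_def raising_pols_def by (intro sum.cong) auto
  also have "\<dots> = Poly_Mapping.lookup f []"
    by (auto simp: lin_ext_def when_def if_distrib in_keys_iff cong: if_cong)
  finally show ?thesis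
    using form_expand[OF herm vac_in_carrier] f raising_pols_subset by auto
qed

text \<open>The letters of \<open>u\<close> move one by one to the second argument, which therefore
  has to be arbitrary in the induction. In the end \<open>v\<^sub>0\<close> stands on the left and
  \<open>form_vac\<close> evaluates both forms.\<close>

lemma form_word_cong:
  assumes H: "contravariant_form n p H" and H': "contravariant_form n p H'"
    and "u \<in> lists raising" "w \<in> carrier (Vbar n p)"
  shows "H (mvec (word_pol u)) w = H' (mvec (word_pol u)) w"
  using assms(3,4)
proof (induction u arbitrary: w)
  case Nil
  then show ?case
    unfolding mvec_Nil Vbar_raising using form_vac[OF H] form_vac[OF H'] by auto
next
  case (Cons x u)
  note x = subsetD[OF raising_subset Cons(1)] and u = mvec_word_in_carrier[OF Cons(2)]
  show ?case
    unfolding mvec_Cons[OF x lists_raising[OF Cons(2)]] contravariant_adjoint[OF H Cons(1) u Cons(4)]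
      contravariant_adjoint[OF H' Cons(1) u Cons(4)]
    by (rule Cons.IH[OF act_in_carrier[OF dual_raising(2)[OF Cons(1)] Cons(4)]])
qed

lemma contravariant_form_unique:
  assumes H: "contravariant_form n p H" and H': "contravariant_form n p H'"
    and v: "v \<in> carrier (Vbar n p)" and w: "w \<in> carrier (Vbar n p)"
  shows "H v w = H' v w"
proof -
  obtain f where f: "f \<in> raising_pols" "w = mvec f"
    using w Vbar_raising by auto
  have herm: "hermitian_form (Vbar n p) H" "hermitian_form (Vbar n p) H'"
    using H H' by (auto simp: contravariant_form_def)
  have fA: "f \<in> pols"
    using f raising_pols_subset by blast
  \<comment> \<open>Hermitian symmetry brings the word into the first argument, where
    \<open>form_word_cong\<close> applies.\<close>
  have "H v (mvec (word_pol u)) = H' v (mvec (word_pol u))" if "u \<in> Poly_Mapping.keys f" for u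
  proof -
    have u: "u \<in> lists raising"
      using f that by (auto simp: raising_pols_def)
    show ?thesis
      using form_word_cong[OF H H' u v] hermitianD(3)[OF herm(1) mvec_word_in_carrier[OF u] v]
        hermitianD(3)[OF herm(2) mvec_word_in_carrier[OF u] v] by simp
  qed
  then show ?thesis
    unfolding f(2) form_expand[OF herm(1) v fA] form_expand[OF herm(2) v fA] lin_ext_def
    by (intro sum.cong) auto
qed

section \<open>The radical as the largest proper submodule\<close>

definition radical :: "Vbar_elt set" where
  "radical = {v \<in> carrier (Vbar n p). \<forall>w\<in>carrier (Vbar n p). wave_form w v = 0}"

context
  assumes p: "p \<ge> 1"
begin

lemma hermitian_wave_form: "hermitian_form (Vbar n p) wave_form"
  using wave_form_contravariant[OF p] by (simp add: contravariant_form_def)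

text \<open>Stability holds because \<open>(i, j, \<sigma>)\<close> acting on a radical vector can
  be moved to the other argument as \<open>(j, i, \<sigma>)\<close>, where it only changes the test
  vector.\<close>

lemma q_submodule_radical: "q_submodule n p radical"
  unfolding q_submodule_def
proof (intro conjI ballI)
  show "submodule radical complex_field (Vbar n p)"
  proof (rule complex_submoduleI[OF module_Vbar])
    interpret Module.module complex_field "Vbar n p" by (rule module_Vbar)
    show "\<zero>\<^bsub>Vbar n p\<^esub> \<in> radical"
      using form_zero_right[OF hermitian_wave_form] mvec_in_carrier[OF pols_closed(6)]
      unfolding mvec_zero[symmetric] radical_def by blast
    show "v \<oplus>\<^bsub>Vbar n p\<^esub> w \<in> radical" if "v \<in> radical" "w \<in> radical" for v w
      using that hermitianD(1)[OF hermitian_wave_form] by (simp add: radical_def)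
    show "c \<odot>\<^bsub>Vbar n p\<^esub> v \<in> radical" if "v \<in> radical" for c v
      using that hermitianD(2)[OF hermitian_wave_form] by (simp add: radical_def)
  qed (auto simp: radical_def)
  fix x v assume x: "x \<in> q_basis n" and v: "v \<in> radical"
  obtain i j \<sigma> where ij: "x = (i, j, \<sigma>)" "i \<le> n" "j \<le> n"
    using x by (auto simp: q_basis_def)
  have vc: "v \<in> carrier (Vbar n p)"
    using v by (simp add: radical_def)
  have "wave_form w (act n p x v) = 0" if w: "w \<in> carrier (Vbar n p)" for w
  proof -
    have "act n p (j, i, \<sigma>) w \<in> carrier (Vbar n p)"
      using ij w by (intro act_in_carrier) (auto simp: q_basis_def)
    then show ?thesis
      using v wave_form_adjoint[OF ij(3,2) w vc, of \<sigma>] by (simp add: ij(1) radical_def)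
  qed
  then show "act n p x v \<in> radical"
    using act_in_carrier[OF x vc] by (simp add: radical_def)
qed

lemma radical_proper: "radical \<noteq> carrier (Vbar n p)"
proof -
  have "wave_form (vac n p) (vac n p) = 1"
    using wave_form_contravariant[OF p] by (simp add: contravariant_form_def)
  then have "vac n p \<notin> radical"
    using vac_in_carrier unfolding radical_def by force
  then show ?thesis
    using vac_in_carrier by blast
qed

text \<open>By \<open>Vbar_raising\<close> it suffices to pair \<open>w \<in> W\<close> with raising
  words. Their letters move over to \<open>w\<close> as duals without leaving \<open>W\<close>, and
  the remaining pairing with \<open>v\<^sub>0\<close> is the coefficient of the empty word, which
  vanishes on proper submodules.\<close>

lemma proper_submodule_subset_radical:
  assumes W: "q_submodule n p W" "W \<noteq> carrier (Vbar n p)"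
  shows "W \<subseteq> radical"
proof
  have sub: "submodule W complex_field (Vbar n p)"
    using W(1) by (simp add: q_submodule_def)
  note Wc = subsetD[OF submoduleD(1)[OF sub]]
  have word: "wave_form (mvec (word_pol u)) w = 0" if "u \<in> lists raising" "w \<in> W" for u w
    using that
  proof (induction u arbitrary: w)
    case Nil
    then obtain f where f: "f \<in> raising_pols" "w = mvec f"
      using Wc Vbar_raising by blast
    then show ?case
      using proper_submodule_vac_coeff[OF W f(1)] Nil form_vac[OF wave_form_contravariant[OF p] f(1)]
      by (simp only: mvec_Nil)
  next
    case (Cons x u)
    note x = subsetD[OF raising_subset Cons(1)] and u = mvec_word_in_carrier[OF Cons(2)]
    have "act n p (dual x) w \<in> W"
      using W(1) dual_raising(2)[OF Cons(1)] Cons(4) by (simp add: q_submodule_def)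
    then show ?case
      unfolding mvec_Cons[OF x lists_raising[OF Cons(2)]]
        contravariant_adjoint[OF wave_form_contravariant[OF p] Cons(1) u Wc[OF Cons(4)]]
      by (rule Cons.IH)
  qed
  fix w assume w: "w \<in> W"
  have "wave_form v w = 0" if v: "v \<in> carrier (Vbar n p)" for v
  proof -
    obtain f where f: "f \<in> raising_pols" "v = mvec f"
      using v Vbar_raising by auto
    have "wave_form w (mvec (word_pol u)) = 0" if "u \<in> Poly_Mapping.keys f" for u
    proof -
      have u: "u \<in> lists raising"
        using f that by (auto simp: raising_pols_def)
      show ?thesis
        using word[OF u w] hermitianD(3)[OF hermitian_wave_form mvec_word_in_carrier[OF u] Wc[OF w]] by simp
    qed
    then have "wave_form w v = 0"
      unfolding f(2) form_expand[OF hermitian_wave_form Wc[OF w] subsetD[OF raising_pols_subset f(1)]] lin_ext_def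
      by (intro sum.neutral) simp
    then show ?thesis
      using hermitianD(3)[OF hermitian_wave_form Wc[OF w] v] by simp
  qed
  then show "w \<in> radical"
    using Wc[OF w] by (simp add: radical_def)
qed

text \<open>The greatest element in the definition of \<open>M_max\<close> exists: the radical is
  itself a proper submodule and contains all others.\<close>

lemma M_max_eq_radical: "M_max n p = radical"
  unfolding M_max_def
  using q_submodule_radical radical_proper proper_submodule_subset_radical
  by (intro Greatest_equality) auto

section \<open>Positive definiteness on the quotient\<close>

text \<open>The form is semidefinite, so failure of positivity means norm zero. By
  \<open>wave_inner_null\<close> the vector is then orthogonal to everything, that is, it lies in
  the radical.\<close>

lemma wave_form_self:
  assumes v: "v \<in> carrier (Vbar n p)" and "v \<notin> radical"
  shows "Re (wave_form v v) > 0"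
proof (rule ccontr)
  assume neg: "\<not> ?thesis"
  have pos: "Re vac_norm > 0"
    using vac_wave_pos[OF p] by (simp add: vac_norm_def)
  have "Re (wave_form v v) = Re (wave_inner n p (vec_wave v) (vec_wave v)) / Re vac_norm"
    unfolding wave_form_def by (subst vac_norm_real(1)) simp
  then have "Re (wave_inner n p (vec_wave v) (vec_wave v)) = 0"
    using neg pos wave_inner_nonneg[of n p "vec_wave v"]
    by (simp add: not_less divide_le_0_iff)
  then have "wave_form v w = 0" for w
    by (simp add: wave_form_def wave_inner_null)
  then have "wave_form w v = 0" if "w \<in> carrier (Vbar n p)" for w
    using hermitianD(3)[OF hermitian_wave_form v that] by simp
  then show False
    using assms by (simp add: radical_def)
qed

lemma induced_form_positive_definite:
  assumes H: "contravariant_form n p H"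
  shows "\<exists>K. induces_on_quotient (Vbar n p) (M_max n p) H K \<and> positive_definite (V_irr n p) K"
proof -
  interpret Module.module complex_field "Vbar n p" by (rule module_Vbar)
  have sub: "submodule radical complex_field (Vbar n p)"
    using q_submodule_radical by (simp add: q_submodule_def)
  note quot = quot_space_carrier[OF module_Vbar sub] quot_space_add[OF module_Vbar sub]
    quot_space_smult[OF module_Vbar sub] quot_space_zero[OF module_Vbar sub]
    and quot_eq = quot_space_eq_iff[OF module_Vbar sub]
  have zero: "\<zero>\<^bsub>quot_space (Vbar n p) radical\<^esub> = radical"
    by (rule trans[OF quot_space_zero[OF module_Vbar sub] M.a_coset_add_zero[OF submoduleD(1)[OF sub]]])
  let ?c = "\<lambda>v. radical +>\<^bsub>Vbar n p\<^esub> v"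
  define rep where "rep A = (SOME v. v \<in> carrier (Vbar n p) \<and> A = ?c v)" for A
  \<comment> \<open>The induced form is built from \<open>wave_form\<close>. Another representative
    of a coset differs by a radical vector, which does not change the value; uniqueness identifies
    \<open>wave_form\<close> with \<open>H\<close> afterwards.\<close>
  define K where "K A B = wave_form (rep A) (rep B)" for A B
  have rep: "rep (?c v) \<in> carrier (Vbar n p)" "rep (?c v) \<ominus>\<^bsub>Vbar n p\<^esub> v \<in> radical"
    if "v \<in> carrier (Vbar n p)" for v
  proof -
    have "rep (?c v) \<in> carrier (Vbar n p) \<and> ?c v = ?c (rep (?c v))"
      unfolding rep_def by (rule someI[of _ v]) (simp add: that)
    then show "rep (?c v) \<in> carrier (Vbar n p)" "rep (?c v) \<ominus>\<^bsub>Vbar n p\<^esub> v \<in> radical"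
      using quot_eq that by metis+
  qed
  have rep_right: "wave_form w (rep (?c v)) = wave_form w v"
    if v: "v \<in> carrier (Vbar n p)" and w: "w \<in> carrier (Vbar n p)" for v w
  proof -
    let ?d = "rep (?c v) \<ominus>\<^bsub>Vbar n p\<^esub> v"
    have d: "?d \<in> carrier (Vbar n p)" "wave_form w ?d = 0"
      using rep(2)[OF v] w by (auto simp: radical_def)
    have "v \<oplus>\<^bsub>Vbar n p\<^esub> ?d = rep (?c v)"
      using v rep(1)[OF v] by (metis M.a_comm M.add.inv_closed M.minus_eq M.r_neg2 M.a_lcomm)
    then show ?thesis
      using hermitianD(1)[OF hermitian_wave_form w v d(1)] d(2) by simp
  qed
  have K: "K (?c v) (?c w) = wave_form v w"
    if v: "v \<in> carrier (Vbar n p)" and w: "w \<in> carrier (Vbar n p)" for v w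
    unfolding K_def rep_right[OF w rep(1)[OF v]]
    using rep_right[OF v w] hermitianD(3)[OF hermitian_wave_form w v] hermitianD(3)[OF hermitian_wave_form w rep(1)[OF v]] by simp
  have "induces_on_quotient (Vbar n p) radical H K"
    unfolding induces_on_quotient_def
    using K contravariant_form_unique[OF wave_form_contravariant[OF p] H] by simp
  moreover have "positive_definite (quot_space (Vbar n p) radical) K"
    unfolding positive_definite_def hermitian_form_def
  proof (intro conjI ballI allI impI)
    fix A assume A: "A \<in> carrier (quot_space (Vbar n p) radical)" "A \<noteq> \<zero>\<^bsub>quot_space (Vbar n p) radical\<^esub>"
    then obtain v where v: "v \<in> carrier (Vbar n p)" "A = ?c v"
      by (auto simp: quot)
    have "v \<notin> radical"
    proof
      assume "v \<in> radical"
      then have "A = radical"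
        unfolding v(2) by (rule M.a_coset_join2[OF v(1) submodule.axioms(1)[OF sub]])
      then show False
        using A(2) zero by blast
    qed
    then show "Re (K A A) > 0"
      using wave_form_self[OF v(1)] K[OF v(1) v(1)] v(2) by simp
  next
    fix A B assume "A \<in> carrier (quot_space (Vbar n p) radical)" "B \<in> carrier (quot_space (Vbar n p) radical)"
    then obtain v w where vw: "v \<in> carrier (Vbar n p)" "w \<in> carrier (Vbar n p)" "A = ?c v" "B = ?c w"
      by (auto simp: quot)
    then show "K B A = cnj (K A B)"
      unfolding vw(3,4) K[OF vw(1,2)] K[OF vw(2,1)] by (intro hermitianD(3)[OF hermitian_wave_form])
    show "K A (c \<odot>\<^bsub>quot_space (Vbar n p) radical\<^esub> B) = c * K A B" for c
      using vw K hermitianD(2)[OF hermitian_wave_form] by (simp add: quot)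
    fix C assume "C \<in> carrier (quot_space (Vbar n p) radical)"
    then obtain x where "x \<in> carrier (Vbar n p)" "C = ?c x"
      by (auto simp: quot)
    then show "K A (B \<oplus>\<^bsub>quot_space (Vbar n p) radical\<^esub> C) = K A B + K A C"
      using vw K hermitianD(1)[OF hermitian_wave_form] by (simp add: quot)
  qed
  ultimately show ?thesis
    unfolding V_irr_def M_max_eq_radical by blast
qed

end

end

text \<open>The existence clause keeps the statement about all contravariant forms from being
  vacuous; it is witnessed by \<open>wave_form\<close>.\<close>

theorem proposition6:
  fixes n p :: nat
  assumes "n \<ge> 1" and "p \<ge> 1"
  shows "(\<exists>H. contravariant_form n p H) \<and>
    (\<forall>H. contravariant_form n p H \<longrightarrow>
      (\<exists>K. induces_on_quotient (Vbar n p) (M_max n p) H K \<and> positive_definite (V_irr n p) K))"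
  using wave_form_contravariant induced_form_positive_definite assms(2) by blast

end
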